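(* The para-octonionic projective plane $\mathbb O'P^2$ with the semi-Riemannian metric $g$ below is homogeneous, i.e. its isometry group acts transitively.
   Context: Para-octonions $\mathbb O'=\mathbb H\oplus\mathbb H$ with product $(q_1,q_2)(p_1,p_2)=(q_1p_1+\bar p_2q_2,\ p_2q_1+q_2\bar p_1)$, conjugation $\overline{(q_1,q_2)}=(\bar q_1,-q_2)$, $\langle a,b\rangle=\mathrm{Re}(a\bar b)$, $|a|^2=\langle a,a\rangle$. $\mathbb O'P^2=\mathcal U/_\sim$ where $\mathcal U=\{(1,y,z):1+|y|^2+|z|^2>0\}\cup\{(x,1,z):|x|^2+1+|z|^2>0\}\cup\{(x,y,1):|x|^2+|y|^2+1>0\}$ and $[a,b,c]\sim[d,e,f]$ iff $(a,b,c)=(d\lambda,e\lambda,f\lambda)$ for some $\lambda$ with $|\lambda|^2>0$; charts $[1,u,v]\mapsto(u,v)$, $[u,1,v]\mapsto(u,v)$, $[u,v,1]\mapsto(u,v)$. The metric $g$ (of signature $(8,8)$) is given on each chart, for tangent vector $(du,dv)=(\xi,\eta)$, by $ds^2=\frac{|\xi|^2(1+|v|^2)+|\eta|^2(1+|u|^2)-2\mathrm{Re}[(u\bar v)(\eta\bar\xi)]}{(1+|u|^2+|v|^2)^2}$. *)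

theory Defs
  imports "HOL-Analysis.Analysis"
begin

section \<open>Quaternions as real 4-tuples (a,b,c,d) = a + b i + c j + d k\<close>

type_synonym quat = "real \<times> real \<times> real \<times> real"

definition qone :: quat where "qone = (1, 0, 0, 0)"

fun qmult :: "quat \<Rightarrow> quat \<Rightarrow> quat" where
  "qmult (a1, b1, c1, d1) (a2, b2, c2, d2) =
     (a1*a2 - b1*b2 - c1*c2 - d1*d2,
      a1*b2 + b1*a2 + c1*d2 - d1*c2,
      a1*c2 - b1*d2 + c1*a2 + d1*b2,
      a1*d2 + b1*c2 - c1*b2 + d1*a2)"

fun qconj :: "quat \<Rightarrow> quat" where
  "qconj (a, b, c, d) = (a, -b, -c, -d)"

fun qre :: "quat \<Rightarrow> real" where
  "qre (a, b, c, d) = a"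

type_synonym poct = "quat \<times> quat"

definition pone :: poct where "pone = (qone, 0)"

fun pmult :: "poct \<Rightarrow> poct \<Rightarrow> poct" where
  "pmult (q1, q2) (p1, p2) =
     (qmult q1 p1 + qmult (qconj p2) q2, qmult p2 q1 + qmult q2 (qconj p1))"

fun pconj :: "poct \<Rightarrow> poct" where
  "pconj (q1, q2) = (qconj q1, - q2)"

fun pre :: "poct \<Rightarrow> real" where
  "pre (q1, q2) = qre q1"

definition pinner :: "poct \<Rightarrow> poct \<Rightarrow> real" where
  "pinner a b = pre (pmult a (pconj b))"

definition pnorm2 :: "poct \<Rightarrow> real" where
  "pnorm2 a = pinner a a"

type_synonym triple = "poct \<times> poct \<times> poct"

definition chartD :: "(poct \<times> poct) set" where
  "chartD = {(u, v). 1 + pnorm2 u + pnorm2 v > 0}"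

definition psi :: "nat \<Rightarrow> poct \<times> poct \<Rightarrow> triple" where
  "psi i x = (case x of (u, v) \<Rightarrow>
     if i = 1 then (pone, u, v) else if i = 2 then (u, pone, v) else (u, v, pone))"

definition OU :: "triple set" where
  "OU = (\<Union>i\<in>{1,2,3::nat}. psi i ` chartD)"

definition scal_rel :: "(triple \<times> triple) set" where
  "scal_rel = {((a, b, c), (d, e, f)). (a, b, c) \<in> OU \<and> (d, e, f) \<in> OU \<and>
      (\<exists>l. pnorm2 l > 0 \<and> (a, b, c) = (pmult d l, pmult e l, pmult f l))}"

text \<open>the equivalence relation generated (coincides with scal_rel on OU)\<close>
definition proj_eq :: "(triple \<times> triple) set" where
  "proj_eq = (scal_rel \<union> scal_rel\<inverse>)\<^sup>*"

definition cls :: "triple \<Rightarrow> triple set" where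
  "cls t = proj_eq `` {t}"

definition OP2 :: "triple set set" where
  "OP2 = OU // proj_eq"

definition cdom :: "nat \<Rightarrow> triple set set" where
  "cdom i = {p \<in> OP2. \<exists>x \<in> chartD. cls (psi i x) = p}"

definition chart :: "nat \<Rightarrow> triple set \<Rightarrow> poct \<times> poct" where
  "chart i p = (SOME x. x \<in> chartD \<and> cls (psi i x) = p)"

section \<open>The metric (same formula in every chart)\<close>

definition gq :: "poct \<times> poct \<Rightarrow> poct \<times> poct \<Rightarrow> real" where
  "gq x w = (case x of (u, v) \<Rightarrow> case w of (\<xi>, \<eta>) \<Rightarrow>
     (pnorm2 \<xi> * (1 + pnorm2 v) + pnorm2 \<eta> * (1 + pnorm2 u)
       - 2 * pre (pmult (pmult u (pconj v)) (pmult \<eta> (pconj \<xi>))))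
     / (1 + pnorm2 u + pnorm2 v)^2)"

fun dirderivs :: "('a::real_normed_vector \<Rightarrow> 'b::real_normed_vector) \<Rightarrow> 'a list \<Rightarrow> 'a \<Rightarrow> 'b" where
  "dirderivs f [] = f"
| "dirderivs f (v # vs) = (\<lambda>x. frechet_derivative (dirderivs f vs) (at x) v)"

definition smooth_on :: "'a::real_normed_vector set \<Rightarrow> ('a \<Rightarrow> 'b::real_normed_vector) \<Rightarrow> bool" where
  "smooth_on S f \<longleftrightarrow> open S \<and> (\<forall>vs. dirderivs f vs differentiable_on S)"

definition local_rep :: "(triple set \<Rightarrow> triple set) \<Rightarrow> nat \<Rightarrow> nat \<Rightarrow> poct \<times> poct \<Rightarrow> poct \<times> poct" where
  "local_rep f i j x = chart j (f (cls (psi i x)))"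

definition smooth_map_metric :: "bool \<Rightarrow> (triple set \<Rightarrow> triple set) \<Rightarrow> bool" where
  "smooth_map_metric isom f \<longleftrightarrow>
     (\<forall>p\<in>OP2. \<forall>i\<in>{1,2,3}. \<forall>j\<in>{1,2,3}. p \<in> cdom i \<longrightarrow> f p \<in> cdom j \<longrightarrow>
        (\<exists>S. open S \<and> chart i p \<in> S \<and> S \<subseteq> chartD \<and>
             (\<forall>x\<in>S. f (cls (psi i x)) \<in> cdom j) \<and>
             smooth_on S (local_rep f i j) \<and>
             (isom \<longrightarrow> (\<forall>x\<in>S. \<forall>w. gq (local_rep f i j x)
                   (frechet_derivative (local_rep f i j) (at x) w) = gq x w))))"

definition isometry_OP2 :: "(triple set \<Rightarrow> triple set) \<Rightarrow> bool" where
  "isometry_OP2 f \<longleftrightarrow> bij_betw f OP2 OP2 \<and> smooth_map_metric True f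
      \<and> smooth_map_metric False (inv_into OP2 f)"

end

theory Submission
  imports Defs
begin

text \<open>
  The Veronese map sends \<open>[x, y, z]\<close> to the Hermitian matrix with entries
  \<open>x\<^sub>i x\<^sub>j\<^sup>* / (|x|\<^sup>2 + |y|\<^sup>2 + |z|\<^sup>2)\<close>. It identifies the plane with the matrices of trace 1 that satisfy
  the rank-one equations, and in every chart the metric is half the pull-back of the trace form;
  this last fact is the polarised composition law of the norm. Hence every linear isometry of the
  trace form that preserves this surface, and whose inverse does too, induces an isometry of the plane.

  Coordinate permutations, the maps \<open>(1, u, v) \<mapsto> (1, e u, e\<^sup>* v)\<close> with \<open>|e|\<^sup>2 = 1\<close> (they are
  compatible with the other charts by the Moufang identities), and the Hadamard reflection
  \<open>(x, y, z) \<mapsto> ((x + y) / \<surd>2, (x - y) / \<surd>2, z)\<close> already act transitively. If the first two diagonal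
  entries have positive sum, make the entry between them purely imaginary; the Hadamard reflection
  then makes the two diagonal entries equal to some \<open>h > 0\<close>, the entry between them has norm \<open>h\<^sup>2\<close>
  and can be rotated to \<open>h\<close>, and a second Hadamard reflection makes the second diagonal entry and its
  off-diagonal partners vanish. Doing this twice leads to \<open>diag(1, 0, 0)\<close>.
\<close>

section \<open>Para-octonion algebra\<close>

notation pmult (infixl "\<odot>" 70)

lemma poct_cases:
  obtains x0 x1 x2 x3 y0 y1 y2 y3 where "a = (((x0,x1,x2,x3),(y0,y1,y2,y3))::poct)"
  by (metis prod.exhaust)

lemma bilinear_pmult: "bilinear pmult"
proof -
  have "a \<odot> (b + c) = a \<odot> b + a \<odot> c" "(b + c) \<odot> a = b \<odot> a + c \<odot> a"
    "a \<odot> (r *\<^sub>R b) = r *\<^sub>R (a \<odot> b)" "(r *\<^sub>R b) \<odot> a = r *\<^sub>R (b \<odot> a)" for a b c r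
    by (cases a rule: poct_cases; cases b rule: poct_cases; cases c rule: poct_cases;
        simp add: algebra_simps)+
  then show ?thesis
    unfolding bilinear_def by (auto intro!: linearI)
qed

lemma linear_pconj: "linear pconj"
proof (rule linearI)
  show "pconj (a + b) = pconj a + pconj b" for a b
    by (cases a rule: poct_cases; cases b rule: poct_cases) simp
  show "pconj (r *\<^sub>R a) = r *\<^sub>R pconj a" for r a
    by (cases a rule: poct_cases) simp
qed

lemma linear_pre: "linear pre"
proof (rule linearI)
  show "pre (a + b) = pre a + pre b" for a b
    by (cases a rule: poct_cases; cases b rule: poct_cases) simp
  show "pre (r *\<^sub>R a) = r *\<^sub>R pre a" for r a
    by (cases a rule: poct_cases) simp
qed

interpretation pmult: bounded_bilinear pmult
  using bilinear_pmult by (simp add: bilinear_conv_bounded_bilinear)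

lemma bounded_linear_pconj: "bounded_linear pconj"
  using linear_pconj by (simp add: linear_conv_bounded_linear)

lemmas pconj_linear = linear_add [OF linear_pconj] linear_diff [OF linear_pconj]
  linear_neg [OF linear_pconj] linear_scale [OF linear_pconj] linear_0 [OF linear_pconj]

lemmas pre_linear = linear_add [OF linear_pre] linear_diff [OF linear_pre]
  linear_neg [OF linear_pre] linear_scale [OF linear_pre] linear_0 [OF linear_pre]

lemmas pmult_linear = pmult.add_left pmult.add_right pmult.diff_left pmult.diff_right
  pmult.minus_left pmult.minus_right pmult.scaleR_left pmult.scaleR_right
  pmult.zero_left pmult.zero_right

lemma pone_left [simp]: "pone \<odot> a = a" and pone_right [simp]: "a \<odot> pone = a"
  by (cases a rule: poct_cases; simp add: pone_def qone_def zero_prod_def)+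

lemma pconj_pconj [simp]: "pconj (pconj a) = a"
  by (cases a rule: poct_cases) simp

lemma pconj_pone [simp]: "pconj pone = pone"
  by (simp add: pone_def qone_def zero_prod_def)

lemma pre_pone [simp]: "pre pone = 1"
  by (simp add: pone_def qone_def)

lemma pconj_pmult: "pconj (a \<odot> b) = pconj b \<odot> pconj a"
  by (cases a rule: poct_cases; cases b rule: poct_cases) (simp add: algebra_simps)

lemma pmult_pconj_self: "a \<odot> pconj a = pnorm2 a *\<^sub>R pone"
  by (cases a rule: poct_cases)
    (simp add: pnorm2_def pinner_def pone_def qone_def zero_prod_def algebra_simps)

lemma pinner_coords:
  "pinner ((x0,x1,x2,x3),(y0,y1,y2,y3)) ((u0,u1,u2,u3),(v0,v1,v2,v3)) =
    x0 * u0 + x1 * u1 + x2 * u2 + x3 * u3 - y0 * v0 - y1 * v1 - y2 * v2 - y3 * v3"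
  by (simp add: pinner_def algebra_simps)

lemma pinner_commute: "pinner a b = pinner b a"
  by (cases a rule: poct_cases; cases b rule: poct_cases) (simp add: pinner_coords)

interpretation pinner: bounded_bilinear pinner
proof -
  have "bilinear pinner"
    unfolding bilinear_def pinner_def
    by (intro conjI allI linearI) (simp_all only: pmult_linear pconj_linear pre_linear)
  then show "bounded_bilinear pinner"
    by (simp add: bilinear_conv_bounded_bilinear)
qed

lemma pre_pmult_pmult: "pre ((u \<odot> pconj v) \<odot> (y \<odot> pconj x)) = pinner (u \<odot> pconj v) (x \<odot> pconj y)"
  by (simp add: pinner_def pconj_pmult)

lemma pinner_pconj [simp]: "pinner (pconj a) (pconj b) = pinner a b"
  by (cases a rule: poct_cases; cases b rule: poct_cases) (simp add: pinner_coords)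

lemma pinner_pone [simp]: "pinner a pone = pre a"
  by (simp add: pinner_def)

lemma pnorm2_add: "pnorm2 (a + b) = pnorm2 a + 2 * pinner a b + pnorm2 b"
  by (simp add: pnorm2_def pinner.add_left pinner.add_right pinner_commute [of b a])

lemma pnorm2_diff: "pnorm2 (a - b) = pnorm2 a - 2 * pinner a b + pnorm2 b"
  by (simp add: pnorm2_def pinner.diff_left pinner.diff_right pinner_commute [of b a])

lemma pnorm2_scaleR [simp]: "pnorm2 (r *\<^sub>R a) = r\<^sup>2 * pnorm2 a"
  by (simp add: pnorm2_def pinner.scaleR_left pinner.scaleR_right power2_eq_square)

lemma pnorm2_pconj [simp]: "pnorm2 (pconj a) = pnorm2 a"
  by (simp add: pnorm2_def)

lemma pnorm2_pone [simp]: "pnorm2 pone = 1"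
  by (simp add: pnorm2_def)

text \<open>Checked in coordinates; the right alternative, flexible and Moufang laws below are
  derived from it by conjugation and polarisation.\<close>

lemma pmult_left_alternative: "a \<odot> (a \<odot> b) = (a \<odot> a) \<odot> b"
  by (cases a rule: poct_cases; cases b rule: poct_cases) (simp add: algebra_simps)

text \<open>Makes \<open>pconj a\<close> a combination of \<open>a\<close> and the unit, so that
  alternativity also governs products of \<open>a\<close> with \<open>pconj a\<close>.\<close>

lemma pconj_eq: "pconj a = (2 * pre a) *\<^sub>R pone - a"
  by (cases a rule: poct_cases) (simp add: pone_def qone_def zero_prod_def)

lemma pmult_right_alternative: "(b \<odot> a) \<odot> a = b \<odot> (a \<odot> a)"
  using pmult_left_alternative [of "pconj a" "pconj b"]
  by (metis pconj_pconj pconj_pmult)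

lemma pconj_cancel_left: "a \<odot> (pconj a \<odot> b) = pnorm2 a *\<^sub>R b"
proof -
  have "a \<odot> (pconj a \<odot> b) = (a \<odot> pconj a) \<odot> b"
    by (simp add: pconj_eq pmult_linear pmult_left_alternative)
  then show ?thesis
    by (simp add: pmult_pconj_self pmult_linear)
qed

lemma pconj_cancel_left': "pconj a \<odot> (a \<odot> b) = pnorm2 a *\<^sub>R b"
  using pconj_cancel_left [of "pconj a" b] by simp

lemma pconj_cancel_right: "(b \<odot> a) \<odot> pconj a = pnorm2 a *\<^sub>R b"
  using pconj_cancel_left [of a "pconj b"]
  by (metis pconj_linear(4) pconj_pconj pconj_pmult)

lemma pconj_cancel_right': "(b \<odot> pconj a) \<odot> a = pnorm2 a *\<^sub>R b"
  using pconj_cancel_right [of b "pconj a"] by simp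

lemma pre_pmult_assoc: "pre ((a \<odot> b) \<odot> c) = pre (a \<odot> (b \<odot> c))"
  by (cases a rule: poct_cases; cases b rule: poct_cases; cases c rule: poct_cases)
    (simp add: algebra_simps)

text \<open>Real parts associate, so \<open>pconj b\<close> can be cancelled against
  \<open>b\<close> before \<open>pconj a\<close> meets \<open>a\<close>.\<close>

lemma pnorm2_pmult: "pnorm2 (a \<odot> b) = pnorm2 a * pnorm2 b"
proof -
  have "pnorm2 (a \<odot> b) = pre (((a \<odot> b) \<odot> pconj b) \<odot> pconj a)"
    by (simp add: pnorm2_def pinner_def pconj_pmult pre_pmult_assoc)
  also have "\<dots> = pnorm2 b * pnorm2 a"
    by (simp add: pconj_cancel_right pmult_linear pre_linear pmult_pconj_self)
  finally show ?thesis
    by simp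
qed

section \<open>Associators and the Moufang identities\<close>

definition passoc :: "poct \<Rightarrow> poct \<Rightarrow> poct \<Rightarrow> poct" where
  "passoc a b c = (a \<odot> b) \<odot> c - a \<odot> (b \<odot> c)"

text \<open>Polarisation: the associator vanishes when its first two arguments agree, and expanding
  it at \<open>a + b\<close> leaves the two mixed terms.\<close>

lemma passoc_swap_left: "passoc b a c = - passoc a b c"
proof -
  have "passoc (a + b) (a + b) c = 0" "passoc a a c = 0" "passoc b b c = 0"
    by (simp_all add: passoc_def pmult_left_alternative)
  moreover have "passoc (a + b) (a + b) c = passoc a a c + passoc a b c + passoc b a c + passoc b b c"
    by (simp add: passoc_def pmult_linear)
  ultimately show ?thesis
    by (simp add: eq_neg_iff_add_eq_0 add.commute)
qed

lemma passoc_swap_right: "passoc a c b = - passoc a b c"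
proof -
  have "passoc a (b + c) (b + c) = 0" "passoc a b b = 0" "passoc a c c = 0"
    by (simp_all add: passoc_def pmult_right_alternative)
  moreover have "passoc a (b + c) (b + c) = passoc a b b + passoc a b c + passoc a c b + passoc a c c"
    by (simp add: passoc_def pmult_linear)
  ultimately show ?thesis
    by (simp add: eq_neg_iff_add_eq_0 add.commute)
qed

lemma pmult_flexible: "(a \<odot> x) \<odot> a = a \<odot> (x \<odot> a)"
  using passoc_swap_right [of x a a] passoc_swap_left [of x a a]
  by (simp add: passoc_def pmult_right_alternative)

text \<open>The difference is a sum of two associators. Skew symmetry moves \<open>a\<close> to the
  front, where left alternativity absorbs it; what remains cancels by skew symmetry in
  \<open>x\<close> and \<open>y\<close>.\<close>

lemma moufang_left: "(a \<odot> (x \<odot> a)) \<odot> y = a \<odot> (x \<odot> (a \<odot> y))"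
proof -
  have "(a \<odot> (x \<odot> a)) \<odot> y - a \<odot> (x \<odot> (a \<odot> y)) = passoc (a \<odot> x) a y + passoc a x (a \<odot> y)"
    by (simp add: pmult_flexible passoc_def)
  also have "\<dots> = - passoc a (a \<odot> x) y - passoc a (a \<odot> y) x"
    by (simp add: passoc_swap_left [of "a \<odot> x"] passoc_swap_right [of a x])
  also have "\<dots> = a \<odot> (passoc a x y + passoc a y x) - (passoc (a \<odot> a) x y + passoc (a \<odot> a) y x)"
    by (simp add: passoc_def pmult_linear pmult_left_alternative)
  also have "\<dots> = 0"
    by (simp add: passoc_swap_right [of _ y x] pmult_linear)
  finally show ?thesis by simp
qed

lemma moufang_right: "y \<odot> (a \<odot> (x \<odot> a)) = ((y \<odot> a) \<odot> x) \<odot> a"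
proof -
  have "pconj (((y \<odot> a) \<odot> x) \<odot> a) = pconj (y \<odot> (a \<odot> (x \<odot> a)))"
    by (simp add: pconj_pmult moufang_left [symmetric] pmult_flexible)
  then show ?thesis
    by (metis pconj_pconj)
qed

text \<open>Both sides differ by two associators. \<open>moufang_left\<close> pulls the outer
  \<open>a\<close> out of one of them, and cyclic invariance matches it with the other.\<close>

lemma moufang_middle: "(a \<odot> x) \<odot> (y \<odot> a) = a \<odot> ((x \<odot> y) \<odot> a)"
proof -
  have "(a \<odot> x) \<odot> (y \<odot> a) = a \<odot> ((x \<odot> y) \<odot> a) + passoc a x (y \<odot> a) - a \<odot> passoc x y a"
    by (simp add: passoc_def pmult_linear)
  moreover have "passoc a x (y \<odot> a) = a \<odot> passoc y a x"
    by (subst passoc_swap_right) (simp add: passoc_def pmult_linear moufang_left)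
  moreover have "passoc y a x = passoc x y a"
    by (metis passoc_swap_right passoc_swap_left)
  ultimately show ?thesis by simp
qed

text \<open>Cancellation of \<open>pconj a\<close> against \<open>a\<close> across brackets; this
  makes \<open>hturn\<close> respect two of the off-diagonal equations of the surface.\<close>

lemma moufang_cancel:
  "(x \<odot> pconj a) \<odot> (a \<odot> (y \<odot> a)) = pnorm2 a *\<^sub>R ((x \<odot> y) \<odot> a)"
  by (simp add: moufang_right pconj_cancel_right' pmult_linear)

text \<open>The composition law is polarised first in the left factor (\<open>left\<close>), then in
  the right one by putting \<open>b + d\<close> for \<open>b\<close>. This is the source of the
  cross term of the metric.\<close>

lemma pinner_pmult_exchange:
  "pinner (a \<odot> b) (c \<odot> d) + pinner (a \<odot> d) (c \<odot> b) = 2 * pinner a c * pinner b d"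
proof -
  have left: "pinner (a \<odot> b) (c \<odot> b) = pinner a c * pnorm2 b" for a b c
    using pnorm2_pmult [of "a + c" b] by (simp add: pmult_linear pnorm2_add pnorm2_pmult algebra_simps)
  show ?thesis
    using left [of a "b + d" c]
    by (simp add: left pmult_linear pnorm2_add pinner.add_left pinner.add_right algebra_simps)
qed

section \<open>Smooth functions\<close>

text \<open>Unlike \<open>dirderivs\<close>, which adds derivatives on the outside, the recursion
  differentiates \<open>f\<close> first, so that closure properties follow by induction on the
  order. Order 0 already asks for differentiability, as the empty list does in
  \<open>smooth_on\<close>.\<close>

primrec smooth_upto :: "nat \<Rightarrow> 'a::real_normed_vector set \<Rightarrow> ('a \<Rightarrow> 'b::real_normed_vector) \<Rightarrow> bool" where
  "smooth_upto 0 S f \<longleftrightarrow> f differentiable_on S"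
| "smooth_upto (Suc k) S f \<longleftrightarrow> f differentiable_on S \<and>
     (\<forall>v. smooth_upto k S (\<lambda>x. frechet_derivative f (at x) v))"

lemma smooth_upto_imp_differentiable_on: "smooth_upto k S f \<Longrightarrow> f differentiable_on S"
  by (cases k) auto

lemma dirderivs_snoc: "dirderivs f (vs @ [v]) = dirderivs (\<lambda>x. frechet_derivative f (at x) v) vs"
  by (induction vs) auto

lemma smooth_onI:
  assumes "open S" and "\<And>k. smooth_upto k S f"
  shows "smooth_on S f"
proof -
  have "smooth_upto (length vs) S f \<Longrightarrow> dirderivs f vs differentiable_on S" for vs
    by (induction vs arbitrary: f rule: rev_induct) (auto simp: dirderivs_snoc simp del: dirderivs.simps(2))
  then show ?thesis
    using assms by (simp add: smooth_on_def)
qed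

lemma has_derivative_transform_open:
  assumes "open S" "x \<in> S" "(f has_derivative f') (at x)" "\<And>y. y \<in> S \<Longrightarrow> f y = g y"
  shows "(g has_derivative f') (at x)"
  using has_derivative_transform_within_open [OF assms(3,1,2)] assms(4) by blast

text \<open>Frechet derivatives depend only on germs, so on an open set agreement passes on to
  them.\<close>

lemma smooth_upto_cong:
  assumes "open S" "\<And>x. x \<in> S \<Longrightarrow> f x = g x" "smooth_upto k S f"
  shows "smooth_upto k S g"
  using assms(2,3)
proof (induction k arbitrary: f g)
  case 0
  then show ?case
    by (metis differentiable_on_def differentiable_transform_within smooth_upto.simps(1) zero_less_one)
next
  case (Suc k)
  have D: "(f has_derivative frechet_derivative f (at x)) (at x)" if "x \<in> S" for x
    using Suc.prems(2) that assms(1) 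
    by (metis differentiable_on_eq_differentiable_at frechet_derivative_works smooth_upto.simps(2))
  have D': "(g has_derivative frechet_derivative f (at x)) (at x)" if "x \<in> S" for x
    using has_derivative_transform_open [OF assms(1) that D [OF that]] Suc.prems(1) by simp
  then have "frechet_derivative f (at x) v = frechet_derivative g (at x) v" if "x \<in> S" for x v
    using frechet_derivative_at [OF D' [OF that]] by simp
  then have "smooth_upto k S (\<lambda>x. frechet_derivative g (at x) v)" for v
    using Suc.IH [of "\<lambda>x. frechet_derivative f (at x) v" "\<lambda>x. frechet_derivative g (at x) v"]
      Suc.prems(2) by auto
  moreover have "g differentiable_on S"
    using D' by (auto simp: differentiable_on_def differentiable_def intro: has_derivative_at_withinI)
  ultimately show ?case by simp
qed

text \<open>By uniqueness of derivatives, any explicit derivative may stand in for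
  \<open>frechet_derivative\<close>.\<close>

lemma smooth_upto_SucI:
  assumes "open S"
    and D: "\<And>x. x \<in> S \<Longrightarrow> (f has_derivative f' x) (at x)"
    and "\<And>v. smooth_upto k S (\<lambda>x. f' x v)"
  shows "smooth_upto (Suc k) S f"
proof -
  have "f differentiable_on S"
    using D by (auto simp: differentiable_on_def differentiable_def intro: has_derivative_at_withinI)
  moreover have "smooth_upto k S (\<lambda>x. frechet_derivative f (at x) v)" for v
  proof (rule smooth_upto_cong [OF assms(1) _ assms(3) [of v]])
    show "f' x v = frechet_derivative f (at x) v" if "x \<in> S" for x
      using frechet_derivative_at [OF D [OF that]] by simp
  qed
  ultimately show ?thesis by simp
qed

lemma smooth_upto_has_derivative:
  assumes "open S" "smooth_upto k S f" "x \<in> S"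
  shows "(f has_derivative frechet_derivative f (at x)) (at x)"
  using assms smooth_upto_imp_differentiable_on [OF assms(2)]
  by (metis differentiable_on_eq_differentiable_at frechet_derivative_works)

lemma smooth_upto_Suc_imp: "smooth_upto (Suc k) S f \<Longrightarrow> smooth_upto k S f"
  by (induction k arbitrary: f) auto

lemma smooth_upto_const: "open S \<Longrightarrow> smooth_upto k S (\<lambda>x. c)"
proof (induction k arbitrary: c)
  case (Suc k)
  show ?case
    by (rule smooth_upto_SucI [OF Suc.prems has_derivative_const]) (rule Suc.IH [OF Suc.prems])
qed simp

lemma smooth_upto_bounded_linear:
  assumes "open S" "bounded_linear f"
  shows "smooth_upto k S f"
proof (cases k)
  case 0
  then show ?thesis
    using assms by (simp add: bounded_linear_imp_differentiable_on)
next
  case (Suc n)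
  show ?thesis
    unfolding Suc using assms
    by (intro smooth_upto_SucI [where f' = "\<lambda>x. f"])
      (auto intro: smooth_upto_const bounded_linear_imp_has_derivative)
qed

lemma smooth_upto_add:
  assumes "open S" "smooth_upto k S f" "smooth_upto k S g"
  shows "smooth_upto k S (\<lambda>x. f x + g x)"
  using assms(2,3)
proof (induction k arbitrary: f g)
  case 0
  then show ?case by simp
next
  case (Suc k)
  show ?case
    using Suc.IH Suc.prems smooth_upto_has_derivative [OF assms(1) Suc.prems(1)]
      smooth_upto_has_derivative [OF assms(1) Suc.prems(2)]
    by (intro smooth_upto_SucI [OF assms(1) has_derivative_add]) auto
qed

lemma (in bounded_bilinear) smooth_upto:
  assumes "open S" "smooth_upto k S f" "smooth_upto k S g"
  shows "smooth_upto k S (\<lambda>x. prod (f x) (g x))"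
  using assms(2,3)
proof (induction k arbitrary: f g)
  case 0
  then show ?case
    by (simp add: differentiable_on_def differentiable_def) (blast intro: FDERIV)
next
  case (Suc k)
  \<comment> \<open>Each summand of the product rule is again a \<open>prod\<close> with one factor
    differentiated, so the induction hypothesis applies; the other factor is needed only to order
    \<open>k\<close>.\<close>
  have "smooth_upto k S (\<lambda>x. prod (f x) (frechet_derivative g (at x) v) +
      prod (frechet_derivative f (at x) v) (g x))" for v
    using Suc.prems Suc.prems [THEN smooth_upto_Suc_imp]
    by (intro smooth_upto_add [OF assms(1)] Suc.IH) auto
  then show ?case
    using smooth_upto_has_derivative [OF assms(1) Suc.prems(1)]
      smooth_upto_has_derivative [OF assms(1) Suc.prems(2)]
    by (intro smooth_upto_SucI [OF assms(1) FDERIV]) auto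
qed

lemma smooth_upto_inverse:
  fixes f :: "'a::real_normed_vector \<Rightarrow> real"
  assumes "open S" "\<And>x. x \<in> S \<Longrightarrow> f x \<noteq> 0" "smooth_upto k S f"
  shows "smooth_upto k S (\<lambda>x. inverse (f x))"
  using assms(3)
proof (induction k)
  case 0
  then show ?case
    using assms(2) by (auto simp: differentiable_on_def intro: differentiable_inverse)
next
  case (Suc k)
  note mult = bounded_bilinear.smooth_upto [OF bounded_bilinear_mult assms(1)]
  have inv: "smooth_upto k S (\<lambda>x. inverse (f x))"
    by (rule Suc.IH [OF Suc.prems [THEN smooth_upto_Suc_imp]])
  \<comment> \<open>The derivative of the inverse contains the inverse itself, but only to order
    \<open>k\<close>, where the induction hypothesis supplies it.\<close>
  have "smooth_upto k S (\<lambda>x. (- 1) * (inverse (f x) * frechet_derivative f (at x) v * inverse (f x)))" for v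
    using Suc.prems by (intro mult inv smooth_upto_const assms(1)) auto
  then show ?case
    using smooth_upto_has_derivative [OF assms(1) Suc.prems] assms(2)
    by (intro smooth_upto_SucI [OF assms(1) Deriv.has_derivative_inverse]) auto
qed

lemma smooth_upto_linear_compose:
  assumes "open S" "bounded_linear h" "smooth_upto k S f"
  shows "smooth_upto k S (\<lambda>x. h (f x))"
  using assms(3)
proof (induction k arbitrary: f)
  case 0
  then show ?case
    using bounded_linear.has_derivative [OF assms(2)]
    by (simp add: differentiable_on_def differentiable_def) blast
next
  case (Suc k)
  then show ?case
    using smooth_upto_has_derivative [OF assms(1) Suc.prems]
    by (intro smooth_upto_SucI [OF assms(1) bounded_linear.has_derivative [OF assms(2)]]) auto
qed

lemma smooth_upto_Pair:
  assumes "open S" "smooth_upto k S f" "smooth_upto k S g"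
  shows "smooth_upto k S (\<lambda>x. (f x, g x))"
proof -
  have "smooth_upto k S (\<lambda>x. (f x, 0) + (0, g x))"
    using assms by (intro smooth_upto_add smooth_upto_linear_compose [where h = "\<lambda>y. (y, 0)"]
        smooth_upto_linear_compose [where h = "\<lambda>y. (0, y)"])
      (auto intro: bounded_linear_intros)
  then show ?thesis by simp
qed

section \<open>The Veronese model\<close>

text \<open>\<open>(r, s, t, a, b, c)\<close> is the Hermitian matrix with diagonal \<open>r, s, t\<close> and entries \<open>a, b, c\<close> at
  positions 12, 13, 23.\<close>

type_synonym herm = "real \<times> real \<times> real \<times> poct \<times> poct \<times> poct"

fun veronese :: "triple \<Rightarrow> herm" where
  "veronese (x, y, z) = inverse (pnorm2 x + pnorm2 y + pnorm2 z) *\<^sub>R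
     (pnorm2 x, pnorm2 y, pnorm2 z, x \<odot> pconj y, x \<odot> pconj z, y \<odot> pconj z)"

text \<open>Trace 1 and vanishing Freudenthal adjoint: three principal minors and three off-diagonal
  cofactors.\<close>

definition veronese_surface :: "herm set" where
  "veronese_surface = {(r, s, t, a, b, c). r + s + t = 1 \<and>
     pnorm2 a = r * s \<and> pnorm2 b = r * t \<and> pnorm2 c = s * t \<and>
     a \<odot> c = s *\<^sub>R b \<and> pconj a \<odot> b = r *\<^sub>R c \<and> b \<odot> pconj c = t *\<^sub>R a}"

lemma veronese_surface_iff:
  "(r, s, t, a, b, c) \<in> veronese_surface \<longleftrightarrow> r + s + t = 1 \<and>
     pnorm2 a = r * s \<and> pnorm2 b = r * t \<and> pnorm2 c = s * t \<and>
     a \<odot> c = s *\<^sub>R b \<and> pconj a \<odot> b = r *\<^sub>R c \<and> b \<odot> pconj c = t *\<^sub>R a"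
  by (simp add: veronese_surface_def)

text \<open>The trace of the square of the matrix, that is, the trace form as a quadratic
  form.\<close>

fun hnorm :: "herm \<Rightarrow> real" where
  "hnorm (r, s, t, a, b, c) = r\<^sup>2 + s\<^sup>2 + t\<^sup>2 + 2 * (pnorm2 a + pnorm2 b + pnorm2 c)"

fun hdiag :: "nat \<Rightarrow> herm \<Rightarrow> real" where
  "hdiag i (r, s, t, a, b, c) = (if i = 1 then r else if i = 2 then s else t)"

text \<open>Column \<open>i\<close> without its diagonal entry. If coordinate \<open>i\<close> is
  \<open>pone\<close>, it is proportional to the other two coordinates, so dividing by the diagonal
  entry in \<open>hchart\<close> gives the chart value.\<close>

fun hcolumn :: "nat \<Rightarrow> herm \<Rightarrow> poct \<times> poct" where
  "hcolumn i (r, s, t, a, b, c) =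
     (if i = 1 then (pconj a, pconj b) else if i = 2 then (a, pconj c) else (b, c))"

definition hchart :: "nat \<Rightarrow> herm \<Rightarrow> poct \<times> poct" where
  "hchart i m = inverse (hdiag i m) *\<^sub>R hcolumn i m"

lemma linear_hdiag: "linear (hdiag i)"
  by (rule linearI) auto

lemma linear_hcolumn: "linear (hcolumn i)"
  by (rule linearI) (auto simp: pconj_linear)

lemma psi_simps [simp]:
  "psi 1 (u, v) = (pone, u, v)" "psi (Suc 0) (u, v) = (pone, u, v)"
  "psi 2 (u, v) = (u, pone, v)" "psi 3 (u, v) = (u, v, pone)"
  by (simp_all add: psi_def)

lemma chartD_iff: "(u, v) \<in> chartD \<longleftrightarrow> 1 + pnorm2 u + pnorm2 v > 0"
  by (simp add: chartD_def)

lemma psi_in_OU: "i \<in> {1, 2, 3} \<Longrightarrow> x \<in> chartD \<Longrightarrow> psi i x \<in> OU"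
  by (auto simp: OU_def)

lemma OU_cases:
  assumes "t \<in> OU"
  obtains i x where "i \<in> {1, 2, 3::nat}" "x \<in> chartD" "t = psi i x"
  using assms unfolding OU_def by blast

lemma hchart_veronese_psi:
  assumes "x \<in> chartD" "i \<in> {1, 2, 3}"
  shows "hdiag i (veronese (psi i x)) > 0" "hchart i (veronese (psi i x)) = x"
  using assms by (cases x; auto simp: chartD_iff hchart_def pconj_linear add.commute)+

text \<open>One coordinate is the unit, so each equation involves at most two para-octonions and the
  cancellation laws suffice.\<close>

lemma veronese_in_surface:
  assumes "t \<in> OU"
  shows "veronese t \<in> veronese_surface"
  using assms
proof (cases rule: OU_cases)
  case (1 i x)
  obtain u v where x: "x = (u, v)" by (metis prod.exhaust)
  define n where "n = inverse (1 + pnorm2 u + pnorm2 v)"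
  have n: "n + n * pnorm2 u + n * pnorm2 v = 1"
    using left_inverse [of "1 + pnorm2 u + pnorm2 v"] 1(2)
    unfolding n_def x chartD_iff by (simp add: algebra_simps)
  have vals: "veronese (pone, u, v) = n *\<^sub>R (1, pnorm2 u, pnorm2 v, pconj u, pconj v, u \<odot> pconj v)"
    "veronese (u, pone, v) = n *\<^sub>R (pnorm2 u, 1, pnorm2 v, u, u \<odot> pconj v, pconj v)"
    "veronese (u, v, pone) = n *\<^sub>R (pnorm2 u, pnorm2 v, 1, u \<odot> pconj v, u, v)"
    by (simp_all add: n_def algebra_simps)
  from 1(1) show ?thesis
    unfolding 1(3) x using n
    by (elim insertE emptyE) (simp_all add: vals veronese_surface_iff pmult_linear pconj_linear pnorm2_pmult pconj_pmult
        pconj_cancel_left pconj_cancel_left' pconj_cancel_right pconj_cancel_right'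
        power2_eq_square algebra_simps del: veronese.simps)
qed

text \<open>The rank-one equations recover every entry from column \<open>i\<close> once its
  diagonal entry is invertible.\<close>

lemma veronese_psi_hchart:
  assumes "m \<in> veronese_surface" "i \<in> {1, 2, 3}" "hdiag i m > 0"
  shows "hchart i m \<in> chartD" "veronese (psi i (hchart i m)) = m"
proof -
  obtain r s t a b c where m: "m = (r, s, t, a, b, c)"
    by (metis prod.exhaust)
  have eqs: "pnorm2 a = r * s" "pnorm2 b = r * t" "pnorm2 c = s * t"
     "a \<odot> c = s *\<^sub>R b" "pconj a \<odot> b = r *\<^sub>R c" "b \<odot> pconj c = t *\<^sub>R a"
    and tr: "r + s + t = 1"
    using assms(1) by (simp_all add: m veronese_surface_iff)
  define k where "k = inverse (hdiag i m)"
  \<comment> \<open>By the norm equations \<open>1 + pnorm2 u + pnorm2 v\<close> will be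
    \<open>k * (r + s + t) = k\<close>, so positivity of \<open>k\<close> is the chart
    condition.\<close>
  have k: "k > 0" "k * r + k * s + k * t = k"
    using assms(3) tr by (simp_all add: k_def flip: distrib_left)
  have kk: "k * hdiag i m = 1"
    using assms(3) by (simp add: k_def)
  have "hchart i m \<in> chartD \<and> veronese (psi i (hchart i m)) = m"
    using assms(2)
  proof (elim insertE emptyE)
    assume i: "i = 1"
    have kr: "k * r = 1" "r * k = 1" using kk by (simp_all add: i m mult.commute)
    have *: "k\<^sup>2 * (r * y) = k * y" for y
      using kr by (simp add: power2_eq_square algebra_simps)
    have **: "inverse k = r"
      using kr by (metis inverse_unique)
    show ?thesis
      using k kr by (simp add: hchart_def k_def [symmetric]) (simp add: i m chartD_iff eqs * ** pmult_linear pconj_linear)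
  next
    assume i: "i = 2"
    have kr: "k * s = 1" "s * k = 1" using kk by (simp_all add: i m mult.commute)
    have *: "k\<^sup>2 * (s * y) = k * y" "k\<^sup>2 * (y * s) = k * y" for y
      using kr by (simp_all add: power2_eq_square algebra_simps)
    have **: "inverse k = s"
      using kr by (metis inverse_unique)
    show ?thesis
      using k kr by (simp add: hchart_def k_def [symmetric]) (simp add: i m chartD_iff eqs * ** pmult_linear pconj_linear)
  next
    assume i: "i = 3"
    have kr: "k * t = 1" "t * k = 1" using kk by (simp_all add: i m mult.commute)
    have *: "k\<^sup>2 * (y * t) = k * y" for y
      using kr by (simp_all add: power2_eq_square algebra_simps)
    have **: "inverse k = t"
      using kr by (metis inverse_unique)
    show ?thesis
      using k kr by (simp add: hchart_def k_def [symmetric]) (simp add: i m chartD_iff eqs * ** pmult_linear pconj_linear)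
  qed
  then show "hchart i m \<in> chartD" "veronese (psi i (hchart i m)) = m"
    by auto
qed


lemma veronese_surface_hdiag_pos:
  assumes "m \<in> veronese_surface"
  obtains i where "i \<in> {1, 2, 3::nat}" "hdiag i m > 0"
proof -
  obtain r s t a b c where m: "m = (r, s, t, a, b, c)"
    by (metis prod.exhaust)
  have "r + s + t = 1"
    using assms by (simp add: m veronese_surface_iff)
  then have "r > 0 \<or> s > 0 \<or> t > 0"
    by linarith
  then have "hdiag 1 m > 0 \<or> hdiag 2 m > 0 \<or> hdiag 3 m > 0"
    by (simp add: m)
  with that show thesis
    by blast
qed

section \<open>Projective equivalence and the Veronese map\<close>

lemma pmult_right_scale_pconj:
  assumes "d = pone \<or> e = pone \<or> d \<odot> l = pone \<or> e \<odot> l = pone"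
  shows "(d \<odot> l) \<odot> pconj (e \<odot> l) = pnorm2 l *\<^sub>R (d \<odot> pconj e)"
proof -
  \<comment> \<open>Without associativity \<open>l\<close> does not cancel freely. A unit factor
    leaves only a cancellation law in two elements; a unit product makes that factor a multiple of
    \<open>pconj l\<close>, with the same effect.\<close>
  have "pnorm2 l *\<^sub>R d = pconj l" if "d \<odot> l = pone" for d
    using pconj_cancel_right [of d l] that by simp
  moreover have "pnorm2 l *\<^sub>R pconj d = l" if "d \<odot> l = pone" for d
    using pconj_cancel_right [of d l] that by (metis pconj_linear(4) pconj_pconj pone_left)
  ultimately show ?thesis
    using assms
    by (elim disjE)
      (simp_all add: pconj_pmult pconj_cancel_left pconj_cancel_right flip: pmult.scaleR_left,
       metis pmult.scaleR_left pmult.scaleR_right)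
qed

lemma veronese_scal_rel:
  assumes "(t, t') \<in> scal_rel"
  shows "veronese t = veronese t'"
proof -
  obtain d e f where t': "t' = (d, e, f)"
    by (metis prod.exhaust)
  obtain l where l: "pnorm2 l > 0" "t = (d \<odot> l, e \<odot> l, f \<odot> l)" and OU: "t \<in> OU" "t' \<in> OU"
    using assms by (auto simp: scal_rel_def t' simp del: split_paired_Ex)
  have ones: "d = pone \<or> e = pone \<or> f = pone" "d \<odot> l = pone \<or> e \<odot> l = pone \<or> f \<odot> l = pone"
    using OU by (auto simp: OU_def t' l psi_def split: prod.splits)
  \<comment> \<open>If neither triple has a unit in a given pair of slots, both units sit in the
    remaining slot, which forces \<open>l = pone\<close>; hence the case split.\<close>
  have eqs: "(d \<odot> l) \<odot> pconj (e \<odot> l) = pnorm2 l *\<^sub>R (d \<odot> pconj e) \<and>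
    (d \<odot> l) \<odot> pconj (f \<odot> l) = pnorm2 l *\<^sub>R (d \<odot> pconj f) \<and>
    (e \<odot> l) \<odot> pconj (f \<odot> l) = pnorm2 l *\<^sub>R (e \<odot> pconj f)"
  proof (cases "l = pone")
    case False
    then show ?thesis
      using ones by (intro conjI pmult_right_scale_pconj) auto
  qed simp
  have "inverse (pnorm2 d * pnorm2 l + pnorm2 e * pnorm2 l + pnorm2 f * pnorm2 l) * pnorm2 l =
      inverse (pnorm2 d + pnorm2 e + pnorm2 f)"
    using l(1) by (simp flip: distrib_right)
  then show ?thesis
    using eqs by (simp add: t' l(2) pnorm2_pmult)
qed

lemma psi_hchart_veronese:
  assumes "pnorm2 x + pnorm2 y + pnorm2 z > 0" "i \<in> {1, 2, 3}" "hdiag i (veronese (x, y, z)) > 0"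
  shows "\<exists>l. pnorm2 l > 0 \<and> psi i (hchart i (veronese (x, y, z))) = (x \<odot> l, y \<odot> l, z \<odot> l)"
proof -
  define n where "n = inverse (pnorm2 x + pnorm2 y + pnorm2 z)"
  have n: "n > 0" using assms(1) by (simp add: n_def)
  \<comment> \<open>Coordinate \<open>i\<close>; the scalar is its inverse \<open>pconj w\<close>
    divided by \<open>pnorm2 w\<close>, which normalises this coordinate to
    \<open>pone\<close>.\<close>
  define w where "w = (if i = 1 then x else if i = 2 then y else z)"
  have w: "pnorm2 w > 0"
    using assms(2,3) n by (auto simp: w_def n_def [symmetric] zero_less_mult_iff)
  have cancel: "inverse (n * pnorm2 w) * n = inverse (pnorm2 w)"
    using n by simp
  show ?thesis
  proof (intro exI conjI)
    show "pnorm2 (inverse (pnorm2 w) *\<^sub>R pconj w) > 0"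
      using w by simp
    show "psi i (hchart i (veronese (x, y, z))) =
      (x \<odot> (inverse (pnorm2 w) *\<^sub>R pconj w), y \<odot> (inverse (pnorm2 w) *\<^sub>R pconj w),
       z \<odot> (inverse (pnorm2 w) *\<^sub>R pconj w))"
      using assms(2) w n
      by (elim insertE emptyE)
        (simp_all add: hchart_def w_def n_def [symmetric] pconj_linear pconj_pmult pmult_linear
          pmult_pconj_self)
  qed
qed

lemma proj_eq_imp:
  assumes "(t, t') \<in> proj_eq" "t \<in> OU"
  shows "t' \<in> OU \<and> veronese t' = veronese t"
  using assms unfolding proj_eq_def
proof (induction rule: rtrancl_induct)
  case (step t1 t2)
  have "t2 \<in> OU"
    using step(2) unfolding scal_rel_def by blast
  moreover have "veronese t2 = veronese t1"
    using step(2) veronese_scal_rel [of t1 t2] veronese_scal_rel [of t2 t1] by (metis UnE converseD)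
  ultimately show ?case
    using step by simp
qed simp

lemma proj_eq_sym: "(t, t') \<in> proj_eq \<Longrightarrow> (t', t) \<in> proj_eq"
  unfolding proj_eq_def by (meson sym_Un_converse sym_rtrancl symD)

lemma proj_eq_trans: "(t, t') \<in> proj_eq \<Longrightarrow> (t', t'') \<in> proj_eq \<Longrightarrow> (t, t'') \<in> proj_eq"
  unfolding proj_eq_def by (rule rtrancl_trans)

lemma OU_sum_pos:
  assumes "(x, y, z) \<in> OU"
  shows "pnorm2 x + pnorm2 y + pnorm2 z > 0"
  using assms
proof (cases rule: OU_cases)
  case (1 i w)
  obtain u v where "w = (u, v)" by (metis prod.exhaust)
  with 1 show ?thesis
    by (auto simp: chartD_iff)
qed

text \<open>\<open>t\<close> is normalised in some chart, so it can be read off from the common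
  image, and what is read off is a multiple of \<open>t'\<close>.\<close>

lemma veronese_eq_imp_proj_eq:
  assumes "t \<in> OU" "t' \<in> OU" "veronese t = veronese t'"
  shows "(t, t') \<in> proj_eq"
  using assms(1)
proof (cases rule: OU_cases)
  case (1 i w)
  obtain x y z where t': "t' = (x, y, z)" by (metis prod.exhaust)
  have t: "t = psi i (hchart i (veronese t'))" "hdiag i (veronese t') > 0"
    using hchart_veronese_psi [OF 1(2,1)] 1(3) assms(3) by simp_all
  obtain l where "pnorm2 l > 0" "t = (x \<odot> l, y \<odot> l, z \<odot> l)"
    using psi_hchart_veronese [OF _ 1(1)] OU_sum_pos assms(2) t unfolding t' by metis
  then have "(t, t') \<in> scal_rel"
    unfolding scal_rel_def t' using assms(1,2) t' by blast
  then show ?thesis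
    by (auto simp: proj_eq_def)
qed

lemma cls_eq_iff:
  assumes "t \<in> OU" "t' \<in> OU"
  shows "cls t = cls t' \<longleftrightarrow> veronese t = veronese t'"
proof
  assume "cls t = cls t'"
  then have "(t', t) \<in> proj_eq"
    by (auto simp: cls_def proj_eq_def)
  then show "veronese t = veronese t'"
    using proj_eq_imp assms by blast
next
  assume "veronese t = veronese t'"
  then have "(t, t') \<in> proj_eq"
    using veronese_eq_imp_proj_eq assms by blast
  then show "cls t = cls t'"
    unfolding cls_def by (blast intro: proj_eq_sym proj_eq_trans)
qed

section \<open>The plane as the Veronese surface, with its charts\<close>

lemma OP2_eq: "OP2 = cls ` OU"
  unfolding OP2_def quotient_def cls_def by blast

text \<open>The Veronese map on classes; the choice of a representative is harmless by
  \<open>cls_eq_iff\<close>.\<close>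

definition embed_OP2 :: "triple set \<Rightarrow> herm" where
  "embed_OP2 p = veronese (SOME t. t \<in> OU \<and> cls t = p)"

lemma embed_OP2_cls:
  assumes "t \<in> OU"
  shows "embed_OP2 (cls t) = veronese t"
proof -
  have "(SOME t'. t' \<in> OU \<and> cls t' = cls t) \<in> OU \<and> cls (SOME t'. t' \<in> OU \<and> cls t' = cls t) = cls t"
    by (rule someI [where x = t]) (use assms in simp)
  then show ?thesis
    unfolding embed_OP2_def using cls_eq_iff assms by blast
qed

lemma bij_betw_embed_OP2: "bij_betw embed_OP2 OP2 veronese_surface"
proof (rule bij_betw_imageI)
  show "inj_on embed_OP2 OP2"
  proof (rule inj_onI)
    fix p q assume "p \<in> OP2" "q \<in> OP2" and eq: "embed_OP2 p = embed_OP2 q"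
    then obtain t t' where "t \<in> OU" "p = cls t" "t' \<in> OU" "q = cls t'"
      unfolding OP2_eq by blast
    with eq show "p = q"
      by (simp add: embed_OP2_cls cls_eq_iff)
  qed
  show "embed_OP2 ` OP2 = veronese_surface"
  proof
    show "embed_OP2 ` OP2 \<subseteq> veronese_surface"
      unfolding OP2_eq by (rule image_subsetI, erule imageE) (simp add: embed_OP2_cls veronese_in_surface)
    show "veronese_surface \<subseteq> embed_OP2 ` OP2"
    proof
      fix m assume m: "m \<in> veronese_surface"
      then obtain i where i: "i \<in> {1, 2, 3::nat}" "hdiag i m > 0"
        by (rule veronese_surface_hdiag_pos)
      have "psi i (hchart i m) \<in> OU" "veronese (psi i (hchart i m)) = m"
        using veronese_psi_hchart [OF m i] i(1) psi_in_OU by blast+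
      then show "m \<in> embed_OP2 ` OP2"
        by (metis OP2_eq embed_OP2_cls image_eqI)
    qed
  qed
qed

lemma embed_OP2_in_surface: "p \<in> OP2 \<Longrightarrow> embed_OP2 p \<in> veronese_surface"
  using bij_betw_embed_OP2 by (rule bij_betwE [THEN bspec])

lemma cdom_iff:
  assumes "i \<in> {1, 2, 3}"
  shows "p \<in> cdom i \<longleftrightarrow> p \<in> OP2 \<and> hdiag i (embed_OP2 p) > 0"
proof
  assume "p \<in> cdom i"
  then obtain x where "p \<in> OP2" "x \<in> chartD" "p = cls (psi i x)"
    unfolding cdom_def by blast
  then show "p \<in> OP2 \<and> hdiag i (embed_OP2 p) > 0"
    using assms embed_OP2_cls psi_in_OU hchart_veronese_psi by metis
next
  assume p: "p \<in> OP2 \<and> hdiag i (embed_OP2 p) > 0"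
  then have x: "hchart i (embed_OP2 p) \<in> chartD" "veronese (psi i (hchart i (embed_OP2 p))) = embed_OP2 p"
    using veronese_psi_hchart assms embed_OP2_in_surface by blast+
  obtain t where t: "t \<in> OU" "p = cls t"
    using p OP2_eq by blast
  have "cls (psi i (hchart i (embed_OP2 p))) = p"
    using x t assms by (metis cls_eq_iff embed_OP2_cls psi_in_OU)
  then show "p \<in> cdom i"
    unfolding cdom_def using p x by blast
qed

text \<open>\<open>hchart i\<close> inverts the Veronese map on chart \<open>i\<close>, so the
  choice made in \<open>chart\<close> is forced.\<close>

lemma chart_eq:
  assumes "i \<in> {1, 2, 3}" "p \<in> cdom i"
  shows "chart i p = hchart i (embed_OP2 p)" "chart i p \<in> chartD" "cls (psi i (chart i p)) = p"
proof -
  obtain y where "y \<in> chartD \<and> cls (psi i y) = p"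
    using assms(2) unfolding cdom_def by blast
  then have "chart i p \<in> chartD \<and> cls (psi i (chart i p)) = p"
    unfolding chart_def by (rule someI)
  then show x: "chart i p \<in> chartD" "cls (psi i (chart i p)) = p"
    by simp_all
  show "chart i p = hchart i (embed_OP2 p)"
    using embed_OP2_cls [OF psi_in_OU [OF assms(1) x(1)]] hchart_veronese_psi(2) [OF x(1) assms(1)] x(2)
    by simp
qed

section \<open>The metric as the pull-back of the trace form\<close>

fun hswap12 :: "herm \<Rightarrow> herm" where
  "hswap12 (r, s, t, a, b, c) = (s, r, t, pconj a, c, b)"

fun hswap23 :: "herm \<Rightarrow> herm" where
  "hswap23 (r, s, t, a, b, c) = (r, t, s, b, a, pconj c)"

lemma linear_hswap12: "linear hswap12"
  by (rule linearI) (auto simp: pconj_linear)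

lemma linear_hswap23: "linear hswap23"
  by (rule linearI) (auto simp: pconj_linear)

lemma hnorm_hswap12 [simp]: "hnorm (hswap12 m) = hnorm m"
  by (cases m rule: hswap12.cases) simp

lemma hnorm_hswap23 [simp]: "hnorm (hswap23 m) = hnorm m"
  by (cases m rule: hswap12.cases) simp

lemma veronese_swap12: "veronese (y, x, z) = hswap12 (veronese (x, y, z))"
  by (simp add: pconj_linear pconj_pmult add.commute)

lemma veronese_swap23: "veronese (x, z, y) = hswap23 (veronese (x, y, z))"
  by (simp add: pconj_linear pconj_pmult add.commute add.left_commute)

text \<open>With \<open>\<alpha> = 1/n\<close> and \<open>\<beta> = n'/n^2\<close>, where
  \<open>n'\<close> is the derivative of \<open>n\<close> in direction
  \<open>(\<xi>, \<eta>)\<close>, the argument of \<open>hnorm\<close> is the quotient-rule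
  derivative of the Veronese map in chart 1. The right-hand side is twice the metric.\<close>

lemma hnorm_combination:
  assumes "n * \<alpha> = 1" "n = 1 + pnorm2 u + pnorm2 v"
    and "\<beta> = 2 * (pinner u \<xi> + pinner v \<eta>) * \<alpha>\<^sup>2"
  shows "hnorm (\<alpha> *\<^sub>R (0, 2 * pinner u \<xi>, 2 * pinner v \<eta>, pconj \<xi>, pconj \<eta>, \<xi> \<odot> pconj v + u \<odot> pconj \<eta>)
      - \<beta> *\<^sub>R (1, pnorm2 u, pnorm2 v, pconj u, pconj v, u \<odot> pconj v)) =
    2 * (pnorm2 \<xi> * (1 + pnorm2 v) + pnorm2 \<eta> * (1 + pnorm2 u)
       - 2 * pinner (u \<odot> pconj v) (\<xi> \<odot> pconj \<eta>)) * \<alpha>\<^sup>2"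
proof -
  define p q U V A B K L where defs: "p = pinner u \<xi>" "q = pinner v \<eta>" "U = pnorm2 u" "V = pnorm2 v"
    "A = pnorm2 \<xi>" "B = pnorm2 \<eta>" "K = pinner (\<xi> \<odot> pconj v) (u \<odot> pconj \<eta>)"
    "L = pinner (u \<odot> pconj v) (\<xi> \<odot> pconj \<eta>)"
  \<comment> \<open>The polarised composition law trades the mixed term \<open>K\<close> for the
    \<open>L\<close> of the metric.\<close>
  have K: "K = 2 * p * q - L"
    using pinner_pmult_exchange [of \<xi> "pconj v" u "pconj \<eta>"]
    by (simp add: defs pinner_commute [of u \<xi>] pinner_commute [of "u \<odot> pconj v"])
  have left: "pinner (a \<odot> b) (c \<odot> b) = pinner a c * pnorm2 b" for a b c
    using pinner_pmult_exchange [of a b c b] by (simp add: pnorm2_def)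
  have right: "pinner (a \<odot> b) (a \<odot> c) = pnorm2 a * pinner b c" for a b c
    using pinner_pmult_exchange [of a b a c] by (simp add: pnorm2_def pinner_commute)
  have nc: "pnorm2 (\<xi> \<odot> pconj v + u \<odot> pconj \<eta>) = A * V + 2 * K + U * B"
    "pinner (\<xi> \<odot> pconj v + u \<odot> pconj \<eta>) (u \<odot> pconj v) = p * V + U * q"
    "pinner \<xi> u = p" "pinner \<eta> v = q"
    by (simp_all add: pnorm2_add pnorm2_pmult pinner.add_left left right defs
        pinner_commute [of \<xi> u] pinner_commute [of \<eta> v])
  have n\<beta>: "n * \<beta> = 2 * (p + q) * \<alpha>"
    using assms(1) unfolding assms(3) defs by (simp add: power2_eq_square)
  have "hnorm (\<alpha> *\<^sub>R (0, 2 * pinner u \<xi>, 2 * pinner v \<eta>, pconj \<xi>, pconj \<eta>, \<xi> \<odot> pconj v + u \<odot> pconj \<eta>)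
      - \<beta> *\<^sub>R (1, pnorm2 u, pnorm2 v, pconj u, pconj v, u \<odot> pconj v)) =
    \<beta>\<^sup>2 + (\<alpha> * (2 * p) - \<beta> * U)\<^sup>2 + (\<alpha> * (2 * q) - \<beta> * V)\<^sup>2 + 2 * ((\<alpha>\<^sup>2 * A - 2 * (\<alpha> * \<beta> * p) + \<beta>\<^sup>2 * U)
      + (\<alpha>\<^sup>2 * B - 2 * (\<alpha> * \<beta> * q) + \<beta>\<^sup>2 * V)
      + (\<alpha>\<^sup>2 * (A * V + 2 * K + U * B) - 2 * (\<alpha> * \<beta> * (p * V + U * q)) + \<beta>\<^sup>2 * (U * V)))"
    by (simp add: pnorm2_diff pinner.scaleR_left pinner.scaleR_right nc pnorm2_pmult)
      (simp add: defs)
  \<comment> \<open>The coefficients of \<open>\<beta>\<close> assemble to powers of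
    \<open>1 + U + V = n\<close>, so \<open>\<beta>\<close> enters only through
    \<open>n * \<beta>\<close>.\<close>
  also have "\<dots> = (n * \<beta>)\<^sup>2 - 4 * \<alpha> * (n * \<beta>) * (p + q) + 4 * \<alpha>\<^sup>2 * (p\<^sup>2 + q\<^sup>2)
      + 2 * \<alpha>\<^sup>2 * (A * (1 + V) + B * (1 + U) + 2 * K)"
    unfolding assms(2) defs(3,4) [symmetric] by (simp add: power2_eq_square algebra_simps)
  \<comment> \<open>The squares leave \<open>- 8 * \<alpha>^2 * p * q\<close>, which cancels the
    \<open>2 * p * q\<close> part of \<open>K\<close>.\<close>
  also have "\<dots> = 2 * (A * (1 + V) + B * (1 + U) - 2 * L) * \<alpha>\<^sup>2"
    unfolding n\<beta> K by (simp add: power2_eq_square algebra_simps)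
  finally show ?thesis
    by (simp add: defs)
qed

lemma veronese_psi1_has_derivative:
  assumes "x \<in> chartD"
  shows "\<exists>D. ((\<lambda>x. veronese (psi 1 x)) has_derivative D) (at x) \<and> (\<forall>w. hnorm (D w) = 2 * gq x w)"
proof -
  obtain u v where x: "x = (u, v)" by (metis prod.exhaust)
  \<comment> \<open>Denominator and numerator of the Veronese map, written with \<open>fst\<close>,
    \<open>snd\<close> and \<open>pinner\<close> so that the product rules for bilinear maps
    apply.\<close>
  define n where "n = (\<lambda>x::poct \<times> poct. 1 + pinner (fst x) (fst x) + pinner (snd x) (snd x))"
  define Y where "Y = (\<lambda>x::poct \<times> poct. (1::real, pinner (fst x) (fst x), pinner (snd x) (snd x),
    pconj (fst x), pconj (snd x), fst x \<odot> pconj (snd x)))"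
  define n' where "n' = (\<lambda>w. 2 * (pinner u (fst w) + pinner v (snd w)))"
  define Y' where "Y' = (\<lambda>w. (0::real, 2 * pinner u (fst w), 2 * pinner v (snd w), pconj (fst w), pconj (snd w),
    fst w \<odot> pconj v + u \<odot> pconj (snd w)))"
  have nx: "n x > 0"
    using assms by (simp add: x chartD_iff n_def pnorm2_def)
  note derivs = has_derivative_fst [OF has_derivative_ident] has_derivative_snd [OF has_derivative_ident]
    bounded_linear.has_derivative [OF bounded_linear_pconj]
  have n': "(n has_derivative n') (at x)"
    unfolding n_def n'_def
    by (auto intro!: derivative_eq_intros pinner.FDERIV simp: x pinner_commute)
  have Y': "(Y has_derivative Y') (at x)"
    unfolding Y_def Y'_def
    by (auto intro!: derivative_eq_intros pinner.FDERIV pmult.FDERIV derivs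
        simp: x pinner_commute add.commute)
  define D where "D = (\<lambda>w. inverse (n x) *\<^sub>R Y' w + (- (inverse (n x) * n' w * inverse (n x))) *\<^sub>R Y x)"
  have "((\<lambda>x. inverse (n x) *\<^sub>R Y x) has_derivative D) (at x)"
    unfolding D_def using nx
    by (intro has_derivative_scaleR Y' Deriv.has_derivative_inverse n') auto
  moreover have "(\<lambda>x. inverse (n x) *\<^sub>R Y x) = (\<lambda>x. veronese (psi 1 x))"
  proof
    fix y :: "poct \<times> poct"
    obtain a b where "y = (a, b)" by (metis prod.exhaust)
    then show "inverse (n y) *\<^sub>R Y y = veronese (psi 1 y)"
      by (simp add: n_def Y_def pnorm2_def)
  qed
  moreover have "hnorm (D w) = 2 * gq x w" for w
  proof -
    obtain \<xi> \<eta> where w: "w = (\<xi>, \<eta>)" by (metis prod.exhaust)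
    have "D w = inverse (n x) *\<^sub>R (0, 2 * pinner u \<xi>, 2 * pinner v \<eta>, pconj \<xi>, pconj \<eta>, \<xi> \<odot> pconj v + u \<odot> pconj \<eta>)
      - (2 * (pinner u \<xi> + pinner v \<eta>) * (inverse (n x))\<^sup>2) *\<^sub>R
        (1, pnorm2 u, pnorm2 v, pconj u, pconj v, u \<odot> pconj v)"
      by (simp add: D_def w x Y_def Y'_def n'_def pnorm2_def power2_eq_square)
    moreover have "n x * inverse (n x) = 1" "n x = 1 + pnorm2 u + pnorm2 v"
      using nx by (simp_all add: n_def x pnorm2_def)
    ultimately show ?thesis
      using hnorm_combination [of "n x" "inverse (n x)" u v _ \<xi> \<eta>]
      by (simp add: gq_def w x pre_pmult_pmult divide_inverse power_inverse)
  qed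
  ultimately show ?thesis
    by (intro exI [of _ D]) simp
qed

lemma linear_isometry_compose_derivative:
  assumes "linear A" "\<And>m. hnorm (A m) = hnorm m"
    and "\<exists>D. (f has_derivative D) (at x) \<and> (\<forall>w. hnorm (D w) = h w)"
  shows "\<exists>D. ((\<lambda>x. A (f x)) has_derivative D) (at x) \<and> (\<forall>w. hnorm (D w) = h w)"
proof -
  obtain D where D: "(f has_derivative D) (at x)" "\<forall>w. hnorm (D w) = h w"
    using assms(3) by blast
  have "((\<lambda>x. A (f x)) has_derivative (\<lambda>w. A (D w))) (at x)"
    using assms(1) D(1) by (simp add: bounded_linear.has_derivative linear_conv_bounded_linear)
  then show ?thesis
    using assms(2) D(2) by (intro exI [of _ "\<lambda>w. A (D w)"]) simp
qed

lemma veronese_psi_has_derivative: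
  assumes "x \<in> chartD" "i \<in> {1, 2, 3}"
  shows "\<exists>D. ((\<lambda>x. veronese (psi i x)) has_derivative D) (at x) \<and> (\<forall>w. hnorm (D w) = 2 * gq x w)"
proof -
  \<comment> \<open>Charts 2 and 3 arise from chart 1 by coordinate transpositions, which preserve
    the trace form; so the metric formula is the same in all three.\<close>
  have psi2: "veronese (psi 2 x) = hswap12 (veronese (psi 1 x))" for x
    by (metis prod.exhaust psi_simps(1,3) veronese_swap12)
  have psi3: "veronese (psi 3 x) = hswap23 (veronese (psi 2 x))" for x
    by (metis prod.exhaust psi_simps(3,4) veronese_swap23)
  note 1 = veronese_psi1_has_derivative [OF assms(1)]
  note 2 = linear_isometry_compose_derivative [OF linear_hswap12 hnorm_hswap12 1]
  note 3 = linear_isometry_compose_derivative [OF linear_hswap23 hnorm_hswap23 2]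
  show ?thesis
    using assms(2) 1 2 3 unfolding psi3 psi2
    by (elim insertE emptyE) (simp_all add: psi2 psi3)
qed

section \<open>Smoothness, and maps of the plane induced by linear isometries\<close>

lemma smooth_upto_veronese:
  fixes x y z :: "'a::real_normed_vector \<Rightarrow> poct"
  assumes S: "open S" and "\<And>p. p \<in> S \<Longrightarrow> pnorm2 (x p) + pnorm2 (y p) + pnorm2 (z p) \<noteq> 0"
    and "smooth_upto k S x" "smooth_upto k S y" "smooth_upto k S z"
  shows "smooth_upto k S (\<lambda>p. veronese (x p, y p, z p))"
  unfolding veronese.simps using assms(2-5) unfolding pnorm2_def
  by (intro bounded_bilinear.smooth_upto [OF bounded_bilinear_scaleR] smooth_upto_inverse
      smooth_upto_add smooth_upto_Pair pinner.smooth_upto pmult.smooth_upto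
      smooth_upto_linear_compose [OF S bounded_linear_pconj] S) auto

lemma smooth_upto_veronese_psi:
  assumes "open S" "S \<subseteq> chartD" "i \<in> {1, 2, 3}"
  shows "smooth_upto k S (\<lambda>x. veronese (psi i x))"
proof -
  have pos: "1 + pnorm2 (fst x) + pnorm2 (snd x) > 0" if "x \<in> S" for x
    using that assms(2) chartD_iff [of "fst x" "snd x"] by auto
  have smooth: "smooth_upto k S fst" "smooth_upto k S snd" "smooth_upto k S (\<lambda>x. pone)"
    using assms(1)
    by (simp_all add: smooth_upto_bounded_linear bounded_linear_fst bounded_linear_snd smooth_upto_const)
  have nonzero: "pnorm2 pone + pnorm2 (fst x) + pnorm2 (snd x) \<noteq> 0"
    "pnorm2 (fst x) + pnorm2 pone + pnorm2 (snd x) \<noteq> 0"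
    "pnorm2 (fst x) + pnorm2 (snd x) + pnorm2 pone \<noteq> 0" if "x \<in> S" for x
    using pos [OF that] by simp_all
  show ?thesis
    using assms(3) smooth_upto_veronese [OF assms(1) nonzero(1) smooth(3,1,2)]
      smooth_upto_veronese [OF assms(1) nonzero(2) smooth(1,3,2)]
      smooth_upto_veronese [OF assms(1) nonzero(3) smooth(1,2,3)]
    by (elim insertE emptyE) (simp_all add: psi_def case_prod_beta del: veronese.simps)
qed

lemma open_chartD: "open chartD"
proof -
  have "open {x::poct \<times> poct. 0 < 1 + pinner (fst x) (fst x) + pinner (snd x) (snd x)}"
    by (intro open_Collect_less continuous_intros pinner.continuous_on)
  also have "{x. 0 < 1 + pinner (fst x) (fst x) + pinner (snd x) (snd x)} = chartD"
    by (simp add: chartD_def pnorm2_def case_prod_unfold)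
  finally show ?thesis .
qed

text \<open>In charts \<open>f\<close> is \<open>hchart j\<close> after \<open>A\<close> after the
  Veronese map, hence rational and smooth. It preserves the metric because both charts pull it back
  from the trace form, which \<open>A\<close> preserves.\<close>

lemma smooth_map_metric_if_linear:
  assumes A: "linear A" and iso: "\<And>m. hnorm (A m) = hnorm m"
    and f: "\<And>p. p \<in> OP2 \<Longrightarrow> f p \<in> OP2" "\<And>p. p \<in> OP2 \<Longrightarrow> embed_OP2 (f p) = A (embed_OP2 p)"
  shows "smooth_map_metric isom f"
  unfolding smooth_map_metric_def
proof (intro ballI impI)
  fix p i j
  assume p: "p \<in> OP2" and i: "i \<in> {1, 2, 3::nat}" and j: "j \<in> {1, 2, 3::nat}"
    and pi: "p \<in> cdom i" and fj: "f p \<in> cdom j"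
  define h where "h = (\<lambda>x. A (veronese (psi i x)))"
  define S where "S = {x \<in> chartD. hdiag j (h x) > 0}"
  define F where "F = local_rep f i j"
  have OP2: "cls (psi i x) \<in> OP2" if "x \<in> chartD" for x
    unfolding OP2_eq using psi_in_OU [OF i that] by (rule imageI)
  have embed_f: "embed_OP2 (f (cls (psi i x))) = h x" if "x \<in> chartD" for x
    unfolding h_def f(2) [OF OP2 [OF that]] embed_OP2_cls [OF psi_in_OU [OF i that]] ..
  have S_cdom: "f (cls (psi i x)) \<in> cdom j" if "x \<in> S" for x
    using that embed_f [of x] OP2 f(1) by (simp add: S_def cdom_iff [OF j])
  have F: "F x = hchart j (h x)" "F x \<in> chartD" "veronese (psi j (F x)) = h x" if "x \<in> S" for x
  proof -
    show Fx: "F x = hchart j (h x)"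
      using chart_eq(1) [OF j S_cdom [OF that]] embed_f [of x] that
      by (simp add: F_def local_rep_def S_def)
    have "h x \<in> veronese_surface"
      using that embed_f [of x] embed_OP2_in_surface [OF f(1) [OF OP2 [of x]]] by (simp add: S_def)
    then show "F x \<in> chartD" "veronese (psi j (F x)) = h x"
      using veronese_psi_hchart [OF _ j] that by (simp_all add: Fx S_def)
  qed
  have bl: "bounded_linear A" "bounded_linear (hdiag j)" "bounded_linear (hcolumn j)"
    using A linear_hdiag linear_hcolumn by (simp_all add: linear_conv_bounded_linear)
  have "open S"
  proof -
    have "hdiag j \<circ> h differentiable_on chartD"
      using smooth_upto_imp_differentiable_on [of 0, OF smooth_upto_linear_compose [OF open_chartD bl(2)
            smooth_upto_linear_compose [OF open_chartD bl(1) smooth_upto_veronese_psi [OF open_chartD _ i]]]]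
      by (simp add: h_def o_def)
    then have "open (chartD \<inter> (hdiag j \<circ> h) -` {0<..})"
      by (intro continuous_open_preimage differentiable_imp_continuous_on open_chartD) auto
    also have "chartD \<inter> (hdiag j \<circ> h) -` {0<..} = S"
      unfolding S_def vimage_def by simp blast
    finally show ?thesis .
  qed
  have S: "S \<subseteq> chartD"
    unfolding S_def by blast
  have smooth: "smooth_upto k S F" for k
  proof (rule smooth_upto_cong [OF \<open>open S\<close>])
    show "inverse (hdiag j (h x)) *\<^sub>R hcolumn j (h x) = F x" if "x \<in> S" for x
      by (simp add: F(1) [OF that] hchart_def)
    have h: "smooth_upto k S h"
      unfolding h_def
      by (intro smooth_upto_linear_compose [OF \<open>open S\<close> bl(1)] smooth_upto_veronese_psi \<open>open S\<close> S i)
    show "smooth_upto k S (\<lambda>x. inverse (hdiag j (h x)) *\<^sub>R hcolumn j (h x))"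
      by (intro bounded_bilinear.smooth_upto [OF bounded_bilinear_scaleR] smooth_upto_inverse \<open>open S\<close>
          smooth_upto_linear_compose [OF \<open>open S\<close> bl(2)] smooth_upto_linear_compose [OF \<open>open S\<close> bl(3)] h)
        (simp add: S_def)
  qed
  have metric: "gq (F x) (frechet_derivative F (at x) w) = gq x w" if xS: "x \<in> S" for x w
  proof -
    obtain D where D: "((\<lambda>x. veronese (psi i x)) has_derivative D) (at x)" "\<And>w. hnorm (D w) = 2 * gq x w"
      using veronese_psi_has_derivative [OF subsetD [OF S xS] i] by blast
    obtain E where E: "((\<lambda>x. veronese (psi j x)) has_derivative E) (at (F x))"
        "\<And>w. hnorm (E w) = 2 * gq (F x) w"
      using veronese_psi_has_derivative [OF F(2) [OF xS] j] by blast
    \<comment> \<open>The identity \<open>veronese (psi j (F y)) = h y\<close> is differentiated on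
      both sides; comparing \<open>hnorm\<close> of the two results avoids computing the derivative
      of \<open>F\<close>.\<close>
    have "((\<lambda>y. veronese (psi j (F y))) has_derivative (\<lambda>w. E (frechet_derivative F (at x) w))) (at x)"
      using has_derivative_compose [OF smooth_upto_has_derivative [OF \<open>open S\<close> smooth that] E(1)] .
    moreover have "(h has_derivative (\<lambda>w. A (D w))) (at x)"
      unfolding h_def by (rule bounded_linear.has_derivative [OF bl(1) D(1)])
    then have "((\<lambda>y. veronese (psi j (F y))) has_derivative (\<lambda>w. A (D w))) (at x)"
      by (rule has_derivative_transform_open [OF \<open>open S\<close> that]) (simp add: F(3))
    ultimately have "(\<lambda>w. E (frechet_derivative F (at x) w)) = (\<lambda>w. A (D w))"
      by (rule has_derivative_unique)
    then have "E (frechet_derivative F (at x) w) = A (D w)"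
      by (rule fun_cong)
    then show ?thesis
      using E(2) [of "frechet_derivative F (at x) w"] D(2) [of w] iso by simp
  qed
  have "chart i p \<in> S"
    using chart_eq(2,3) [OF i pi] embed_f [of "chart i p"] fj by (simp add: S_def cdom_iff [OF j])
  then show "\<exists>S. open S \<and> chart i p \<in> S \<and> S \<subseteq> chartD \<and>
             (\<forall>x\<in>S. f (cls (psi i x)) \<in> cdom j) \<and>
             smooth_on S (local_rep f i j) \<and>
             (isom \<longrightarrow> (\<forall>x\<in>S. \<forall>w. gq (local_rep f i j x)
                   (frechet_derivative (local_rep f i j) (at x) w) = gq x w))"
    unfolding F_def [symmetric]
    using \<open>open S\<close> S S_cdom smooth_onI [OF \<open>open S\<close> smooth] metric by blast
qed

section \<open>Linear symmetries of the Veronese surface\<close>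

definition haut :: "(herm \<Rightarrow> herm) \<Rightarrow> bool" where
  "haut A \<longleftrightarrow> linear A \<and> (\<forall>m. hnorm (A m) = hnorm m) \<and> A ` veronese_surface \<subseteq> veronese_surface"

text \<open>\<open>haut\<close> only gives an inclusion for the image of the surface; the witness
  \<open>B\<close> makes it an equality. Inverses are taken on the surface, where the points of the
  plane live.\<close>

definition haut_group :: "(herm \<Rightarrow> herm) set" where
  "haut_group = {A. haut A \<and> (\<exists>B. haut B \<and> (\<forall>m\<in>veronese_surface. B (A m) = m \<and> A (B m) = m))}"

lemma haut_comp: "haut A \<Longrightarrow> haut B \<Longrightarrow> haut (A \<circ> B)"
  unfolding haut_def by (auto intro: linear_compose simp: image_subset_iff simp del: split_paired_All)

lemma haut_groupI:
  assumes "haut A" "haut B" "\<And>m. B (A m) = m" "\<And>m. A (B m) = m"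
  shows "A \<in> haut_group"
  unfolding haut_group_def using assms by blast

lemma haut_group_surface: "A \<in> haut_group \<Longrightarrow> m \<in> veronese_surface \<Longrightarrow> A m \<in> veronese_surface"
  unfolding haut_group_def haut_def by blast

lemma haut_group_comp:
  assumes "A \<in> haut_group" "B \<in> haut_group"
  shows "A \<circ> B \<in> haut_group"
proof -
  obtain A' where A': "haut A'" "\<And>m. m \<in> veronese_surface \<Longrightarrow> A' (A m) = m \<and> A (A' m) = m"
    using assms(1) unfolding haut_group_def by blast
  obtain B' where B': "haut B'" "\<And>m. m \<in> veronese_surface \<Longrightarrow> B' (B m) = m \<and> B (B' m) = m"
    using assms(2) unfolding haut_group_def by blast
  have "haut (A \<circ> B)" "haut (B' \<circ> A')"
    using assms A' B' haut_comp by (simp_all add: haut_group_def)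
  moreover have "(B' \<circ> A') ((A \<circ> B) m) = m \<and> (A \<circ> B) ((B' \<circ> A') m) = m" if "m \<in> veronese_surface" for m
  proof -
    have "A' m \<in> veronese_surface"
      using A'(1) that unfolding haut_def by blast
    then show ?thesis
      using A'(2) B'(2) that haut_group_surface [OF assms(2)] by simp
  qed
  ultimately show ?thesis
    unfolding haut_group_def by blast
qed

lemma haut_group_inverse:
  assumes "A \<in> haut_group"
  obtains B where "B \<in> haut_group" "\<And>m. m \<in> veronese_surface \<Longrightarrow> B (A m) = m"
proof -
  obtain B where B: "haut A" "haut B" "\<forall>m\<in>veronese_surface. B (A m) = m \<and> A (B m) = m"
    using assms unfolding haut_group_def by blast
  then have "B \<in> haut_group"
    unfolding haut_group_def by blast
  with that B(3) show thesis
    by simp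
qed

text \<open>\<open>A\<close> and its inverse are transported to the plane by the bijection
  \<open>embed_OP2\<close>, and the linear criterion applies to both.\<close>

lemma isometry_if_haut_group:
  assumes "A \<in> haut_group" "p \<in> OP2" "q \<in> OP2" "A (embed_OP2 p) = embed_OP2 q"
  shows "\<exists>f. isometry_OP2 f \<and> f p = q"
proof -
  obtain B where A: "haut A" and B: "haut B"
    and inv: "\<And>m. m \<in> veronese_surface \<Longrightarrow> B (A m) = m" "\<And>m. m \<in> veronese_surface \<Longrightarrow> A (B m) = m"
    using assms(1) unfolding haut_group_def by blast
  have surf: "A m \<in> veronese_surface" "B m \<in> veronese_surface" if "m \<in> veronese_surface" for m
    using A B that unfolding haut_def by blast+
  define lift where "lift = (\<lambda>A p. inv_into OP2 embed_OP2 (A (embed_OP2 p)))"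
  have lift: "lift C p \<in> OP2" "embed_OP2 (lift C p) = C (embed_OP2 p)"
    if "C (embed_OP2 p) \<in> veronese_surface" for C p
    unfolding lift_def
    using that bij_betw_imp_surj_on [OF bij_betw_embed_OP2] by (simp_all add: inv_into_into f_inv_into_f)
  have inj: "p = q" if "p \<in> OP2" "q \<in> OP2" "embed_OP2 p = embed_OP2 q" for p q
    using bij_betw_imp_inj_on [OF bij_betw_embed_OP2] that(3,1,2) by (rule inj_onD)
  note E = embed_OP2_in_surface
  have liftA: "lift A p \<in> OP2" "embed_OP2 (lift A p) = A (embed_OP2 p)" if "p \<in> OP2" for p
    using lift surf(1) [OF E [OF that]] by blast+
  have liftB: "lift B p \<in> OP2" "embed_OP2 (lift B p) = B (embed_OP2 p)" if "p \<in> OP2" for p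
    using lift surf(2) [OF E [OF that]] by blast+
  have BA: "lift B (lift A p) = p" if "p \<in> OP2" for p
    by (rule inj) (simp_all add: that liftA liftB inv E)
  have AB: "lift A (lift B p) = p" if "p \<in> OP2" for p
    by (rule inj) (simp_all add: that liftA liftB inv E)
  have bij: "bij_betw (lift A) OP2 OP2"
    by (rule bij_betw_byWitness [where f' = "lift B"]) (use BA AB liftA liftB in blast)+
  have inv_lift: "inv_into OP2 (lift A) p = lift B p" if "p \<in> OP2" for p
    using bij_betw_imp_inj_on [OF bij] liftB(1) [OF that] AB [OF that] by (rule inv_into_f_eq)
  have "smooth_map_metric True (lift A)"
    using A liftA unfolding haut_def by (intro smooth_map_metric_if_linear [of A]) blast+
  moreover have "smooth_map_metric False (inv_into OP2 (lift A))"
    using B liftB inv_lift unfolding haut_def by (intro smooth_map_metric_if_linear [of B]) auto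
  moreover have "lift A p = q"
    using assms liftA by (intro inj) simp_all
  ultimately show ?thesis
    using bij unfolding isometry_OP2_def by blast
qed

section \<open>Generators: transpositions, turns and the Hadamard reflection\<close>

lemma herm_cases: obtains r s t a b c where "m = ((r, s, t, a, b, c)::herm)"
  by (metis prod.exhaust)

lemma haut_hswap12: "haut hswap12"
  unfolding haut_def
proof (intro conjI allI linear_hswap12 hnorm_hswap12 subsetI, erule imageE)
  fix m m' assume "m' = hswap12 m" "m \<in> veronese_surface"
  then show "m' \<in> veronese_surface"
    by (cases m rule: herm_cases)
      (simp add: veronese_surface_iff mult.commute, metis pconj_linear(4) pconj_pconj pconj_pmult add.commute)
qed

lemma haut_hswap23: "haut hswap23"
  unfolding haut_def
proof (intro conjI allI linear_hswap23 hnorm_hswap23 subsetI, erule imageE)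
  fix m m' assume "m' = hswap23 m" "m \<in> veronese_surface"
  then show "m' \<in> veronese_surface"
    by (cases m rule: herm_cases)
      (simp add: veronese_surface_iff mult.commute, metis pconj_linear(4) pconj_pconj pconj_pmult add.assoc add.commute)
qed

lemma hswap12_in_group: "hswap12 \<in> haut_group"
  by (rule haut_groupI [OF haut_hswap12 haut_hswap12]) (metis (no_types, lifting) herm_cases hswap12.simps pconj_pconj)+

lemma hswap23_in_group: "hswap23 \<in> haut_group"
  by (rule haut_groupI [OF haut_hswap23 haut_hswap23]) (metis (no_types, lifting) herm_cases hswap23.simps pconj_pconj)+

text \<open>Matrix form of \<open>(1, u, v) \<mapsto> (1, e \<odot> u, pconj e \<odot> v)\<close>;
  the middle Moufang identity brings the product of the two new coordinates into the form of the
  last entry.\<close>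

fun hturn :: "poct \<Rightarrow> herm \<Rightarrow> herm" where
  "hturn e (r, s, t, a, b, c) = (r, s, t, a \<odot> pconj e, b \<odot> e, e \<odot> (c \<odot> e))"

lemma haut_hturn:
  assumes "pnorm2 e = 1"
  shows "haut (hturn e)"
  unfolding haut_def
proof (intro conjI allI subsetI)
  show "linear (hturn e)"
  proof (rule linearI)
    show "hturn e (m + m') = hturn e m + hturn e m'" for m m'
      by (cases m rule: herm_cases; cases m' rule: herm_cases) (simp add: pmult_linear)
    show "hturn e (k *\<^sub>R m) = k *\<^sub>R hturn e m" for k m
      by (cases m rule: herm_cases) (simp add: pmult_linear)
  qed
  show "hnorm (hturn e m) = hnorm m" for m
    by (cases m rule: herm_cases) (simp add: pnorm2_pmult assms)
  fix m' assume "m' \<in> hturn e ` veronese_surface"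
  then obtain m where "m' = hturn e m" "m \<in> veronese_surface" by (rule imageE)
  \<comment> \<open>The equations for \<open>a \<odot> c\<close>, \<open>pconj a \<odot> b\<close>
    and \<open>b \<odot> pconj c\<close> follow from \<open>moufang_cancel\<close> at
    \<open>e\<close>, the middle Moufang identity, and \<open>moufang_cancel\<close> at
    \<open>pconj e\<close>, respectively.\<close>
  then show "m' \<in> veronese_surface"
    using assms moufang_cancel [of _ e] moufang_cancel [of _ "pconj e"]
    by (cases m rule: herm_cases)
      (simp add: veronese_surface_iff pnorm2_pmult pmult_linear pconj_pmult moufang_middle pmult_flexible)
qed

lemma hturn_in_group:
  assumes "pnorm2 e = 1"
  shows "hturn e \<in> haut_group"
proof (rule haut_groupI [of _ "hturn (pconj e)"])
  have inv: "hturn (pconj e) (hturn e m) = m" if "pnorm2 e = 1" for e m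
    using that by (cases m rule: herm_cases)
      (simp add: pconj_cancel_right pconj_cancel_right' pconj_cancel_left' flip: pmult_flexible)
  show "hturn (pconj e) (hturn e m) = m" "hturn e (hturn (pconj e) m) = m" for m
    using inv [of e m] inv [of "pconj e" m] assms by simp_all
qed (use assms in \<open>simp_all add: haut_hturn\<close>)

text \<open>Conjugation by the real reflection; its entry 12 is
  \<open>(r - s - a + pconj a) / 2\<close>, rewritten by \<open>pconj_eq\<close>.\<close>

fun hadamard :: "herm \<Rightarrow> herm" where
  "hadamard (r, s, t, a, b, c) = ((r + s) / 2 + pre a, (r + s) / 2 - pre a, t,
     ((r - s) / 2 + pre a) *\<^sub>R pone - a, (1 / sqrt 2) *\<^sub>R (b + c), (1 / sqrt 2) *\<^sub>R (b - c))"

lemma linear_hadamard: "linear hadamard"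
proof (rule linearI)
  show "hadamard (m + m') = hadamard m + hadamard m'" for m m'
    by (cases m rule: herm_cases; cases m' rule: herm_cases)
      (simp add: pre_linear algebra_simps add_divide_distrib diff_divide_distrib)
  show "hadamard (k *\<^sub>R m) = k *\<^sub>R hadamard m" for k m
    by (cases m rule: herm_cases)
      (simp add: pre_linear algebra_simps add_divide_distrib diff_divide_distrib)
qed

lemma hnorm_hadamard: "hnorm (hadamard m) = hnorm m"
proof -
  obtain r s t a b c where m: "m = (r, s, t, a, b, c)"
    by (rule herm_cases)
  have "pnorm2 ((1 / sqrt 2) *\<^sub>R (b + c)) + pnorm2 ((1 / sqrt 2) *\<^sub>R (b - c)) = pnorm2 b + pnorm2 c"
    by (simp add: pnorm2_diff pnorm2_add power_divide field_simps)
  moreover have "pnorm2 (l *\<^sub>R pone - a) = l\<^sup>2 - 2 * (l * pre a) + pnorm2 a" for l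
    by (simp add: pnorm2_diff pinner.scaleR_left pinner_commute [of pone])
  moreover have "((r + s) / 2 + x)\<^sup>2 + ((r + s) / 2 - x)\<^sup>2 +
      2 * (((r - s) / 2 + x)\<^sup>2 - 2 * (((r - s) / 2 + x) * x)) = r\<^sup>2 + s\<^sup>2" for x
    by (simp add: power2_eq_square field_simps)
  ultimately show ?thesis
    unfolding m hadamard.simps hnorm.simps by (smt (verit))
qed

lemma hadamard_in_surface:
  assumes "m \<in> veronese_surface"
  shows "hadamard m \<in> veronese_surface"
proof -
  obtain r s t a b c where m: "m = (r, s, t, a, b, c)"
    by (rule herm_cases)
  define k where "k = 1 / sqrt 2"
  have k: "k * k = 1 / 2" "k * (k * y) = y / 2" for y
    by (simp_all add: k_def)
  have eqs: "pnorm2 a = r * s" "pnorm2 b = r * t" "pnorm2 c = s * t"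
     "a \<odot> c = s *\<^sub>R b" "pconj a \<odot> b = r *\<^sub>R c" "b \<odot> pconj c = t *\<^sub>R a"
    and tr: "r + s + t = 1"
    using assms by (simp_all add: m veronese_surface_iff)
  \<comment> \<open>The new equations mix \<open>b\<close> and \<open>c\<close>, so they also need
    these products; the old equations yield them through \<open>pconj_eq\<close>, conjugation and
    real parts.\<close>
  have ab: "a \<odot> b = (2 * pre a) *\<^sub>R b - r *\<^sub>R c"
    using eqs(5) by (simp add: pconj_eq pmult_linear algebra_simps)
  have cb: "c \<odot> pconj b = t *\<^sub>R pconj a"
    using eqs(6) by (metis pconj_linear(4) pconj_pconj pconj_pmult)
  have bc: "pinner b c = t * pre a"
    by (simp add: pinner_def eqs(6) pre_linear)
  show ?thesis
    unfolding m hadamard.simps veronese_surface_iff k_def [symmetric]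
  proof (intro conjI)
    show "(r + s) / 2 + pre a + ((r + s) / 2 - pre a) + t = 1"
      using tr by simp
    show "pnorm2 (((r - s) / 2 + pre a) *\<^sub>R pone - a) = ((r + s) / 2 + pre a) * ((r + s) / 2 - pre a)"
      by (simp add: pnorm2_diff eqs pinner.scaleR_left pinner_commute [of pone] field_simps power2_eq_square)
    show "pnorm2 (k *\<^sub>R (b + c)) = ((r + s) / 2 + pre a) * t"
      "pnorm2 (k *\<^sub>R (b - c)) = ((r + s) / 2 - pre a) * t"
      by (simp_all add: pnorm2_diff pnorm2_add eqs bc pinner.scaleR_left pinner.scaleR_right
          power2_eq_square k algebra_simps add_divide_distrib)
    show "(((r - s) / 2 + pre a) *\<^sub>R pone - a) \<odot> (k *\<^sub>R (b - c)) = ((r + s) / 2 - pre a) *\<^sub>R (k *\<^sub>R (b + c))"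
      by (simp add: pmult_linear ab eqs(4))
        (cases b rule: poct_cases; cases c rule: poct_cases; simp add: field_simps)
    show "pconj (((r - s) / 2 + pre a) *\<^sub>R pone - a) \<odot> (k *\<^sub>R (b + c)) = ((r + s) / 2 + pre a) *\<^sub>R (k *\<^sub>R (b - c))"
      by (simp add: pconj_linear pconj_eq [of a] pmult_linear ab eqs(4))
        (cases b rule: poct_cases; cases c rule: poct_cases; simp add: field_simps)
    show "(k *\<^sub>R (b + c)) \<odot> pconj (k *\<^sub>R (b - c)) = t *\<^sub>R (((r - s) / 2 + pre a) *\<^sub>R pone - a)"
      by (simp add: pconj_linear pmult_linear pmult_pconj_self eqs cb k)
        (cases a rule: poct_cases; simp add: pone_def qone_def zero_prod_def field_simps k)
  qed
qed

lemma hadamard_in_group: "hadamard \<in> haut_group"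
proof -
  have "haut hadamard"
    using linear_hadamard hnorm_hadamard hadamard_in_surface unfolding haut_def by blast
  moreover have "hadamard (hadamard m) = m" for m
  proof -
    have k: "1 / sqrt 2 * (1 / sqrt 2) = 1 / 2"
      by simp
    have "k *\<^sub>R (k *\<^sub>R (b + c) + k *\<^sub>R (b - c)) = (k * k) *\<^sub>R (b + b)"
      "k *\<^sub>R (k *\<^sub>R (b + c) - k *\<^sub>R (b - c)) = (k * k) *\<^sub>R (c + c)" for k and b c :: poct
      by (simp_all add: algebra_simps)
    from this [of "1 / sqrt 2", unfolded k scaleR_half_double] show ?thesis
      by (cases m rule: herm_cases) (simp add: pre_linear field_simps del: scaleR_scaleR)
  qed
  ultimately show ?thesis
    by (intro haut_groupI [of _ hadamard])
qed


section \<open>Reduction to the base point and transitivity\<close>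

lemma exists_orthogonal_unit: "\<exists>e. pnorm2 e = 1 \<and> pinner a e = 0"
proof (cases a rule: poct_cases)
  case (1 x0 x1 x2 x3 y0 y1 y2 y3)
  show ?thesis
  \<comment> \<open>The unit is sought in the first two coordinates, where the form is positive
    definite: \<open>(x0, x1)\<close> is turned by a right angle and normalised, or any unit is
    taken if it vanishes.\<close>
  proof (cases "x0 = 0 \<and> x1 = 0")
    case True
    then show ?thesis
      by (intro exI [of _ "((1, 0, 0, 0), (0, 0, 0, 0))"]) (simp add: 1 pnorm2_def pinner_coords)
  next
    case False
    then have pos: "x0\<^sup>2 + x1\<^sup>2 > 0"
      by (simp add: sum_power2_gt_zero_iff)
    define d where "d = sqrt (x0\<^sup>2 + x1\<^sup>2)"
    have "d * d = x0\<^sup>2 + x1\<^sup>2" "d > 0"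
      using pos by (simp_all add: d_def)
    then have "(x1 * x1 + x0 * x0) / (d * d) = 1"
      by (metis add.commute divide_self less_irrefl mult_eq_0_iff power2_eq_square)
    then have "x1 / d * (x1 / d) + x0 / d * (x0 / d) = 1"
      by (simp add: add_divide_distrib)
    then show ?thesis
      by (intro exI [of _ "((- x1 / d, x0 / d, 0, 0), (0, 0, 0, 0))"])
        (simp add: 1 pnorm2_def pinner_coords)
  qed
qed

text \<open>The final clause keeps zeros from an earlier pass: the form is indefinite, so the norm
  equations alone would allow a nonzero null \<open>b'\<close>.\<close>

lemma haut_group_clear_off_diagonal:
  assumes m: "(r, s, t, a, b, c) \<in> veronese_surface" and pos: "r + s > 0"
  shows "\<exists>A\<in>haut_group. \<exists>b'. A (r, s, t, a, b, c) = (r + s, 0, t, 0, b', 0) \<and> (b = 0 \<and> c = 0 \<longrightarrow> b' = 0)"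
proof -
  obtain e where e: "pnorm2 e = 1" "pinner a e = 0"
    using exists_orthogonal_unit by blast
  define h where "h = (r + s) / 2"
  define a1 where "a1 = ((r - s) / 2) *\<^sub>R pone - a \<odot> pconj e"
  \<comment> \<open>Since \<open>pinner a e = 0\<close>, the turned entry is purely imaginary, so
    the reflection makes both diagonal entries \<open>h\<close>.\<close>
  obtain b1 c1 where m1: "hadamard (hturn e (r, s, t, a, b, c)) = (h, h, t, a1, b1, c1)"
    and z1: "b = 0 \<and> c = 0 \<longrightarrow> b1 = 0 \<and> c1 = 0"
    using e(2) by (simp add: pinner_def h_def a1_def pmult_linear)
  have "(h, h, t, a1, b1, c1) \<in> veronese_surface"
    using haut_group_surface [OF hadamard_in_group haut_group_surface [OF hturn_in_group [OF e(1)] m]]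
    by (simp only: m1)
  then have a1: "pnorm2 a1 = h * h"
    by (simp add: veronese_surface_iff)
  have h: "h > 0"
    using pos by (simp add: h_def)
  define f where "f = (1 / h) *\<^sub>R a1"
  have f: "pnorm2 f = 1" "a1 \<odot> pconj f = h *\<^sub>R pone"
    using h by (simp_all add: f_def a1 power2_eq_square pconj_linear pmult_linear pmult_pconj_self)
  \<comment> \<open>The turn makes the off-diagonal entry \<open>h\<close>, and the reflection sends
    the block with all entries \<open>h\<close> to \<open>diag(2 h, 0)\<close>.\<close>
  obtain b2 c2 where m2: "hadamard (hturn f (h, h, t, a1, b1, c1)) = (r + s, 0, t, 0, b2, c2)"
    and z2: "b1 = 0 \<and> c1 = 0 \<longrightarrow> b2 = 0"
    using f(2) by (simp add: h_def pmult_linear pre_linear)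
  define A where "A = hadamard \<circ> hturn f \<circ> (hadamard \<circ> hturn e)"
  have A: "A \<in> haut_group"
    unfolding A_def by (intro haut_group_comp hadamard_in_group hturn_in_group e f)
  have Am: "A (r, s, t, a, b, c) = (r + s, 0, t, 0, b2, c2)"
    by (simp only: A_def o_apply m1 m2)
  have "(r + s, 0, t, 0, b2, c2) \<in> veronese_surface"
    using haut_group_surface [OF A m] by (simp only: Am)
  \<comment> \<open>The norm equation only makes \<open>c2\<close> null; it vanishes by
    \<open>pconj a \<odot> b = r *\<^sub>R c\<close>, whose left side is 0 here.\<close>
  then have "c2 = 0"
    using pos by (simp add: veronese_surface_iff linear_0 [OF linear_pconj] pmult_linear)
  with A Am z1 z2 show ?thesis
    by blast
qed

lemma haut_group_to_base:
  assumes "m \<in> veronese_surface"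
  shows "\<exists>A\<in>haut_group. A m = (1, 0, 0, 0, 0, 0)"
proof -
  have two: "\<exists>A\<in>haut_group. A m = (1, 0, 0, 0, 0, 0)"
    if m: "m \<in> veronese_surface" "m = (r, s, t, a, b, c)" and pos: "r + s > 0" for m r s t a b c
  proof -
    obtain A b' where A: "A \<in> haut_group" "A m = (r + s, 0, t, 0, b', 0)"
      using haut_group_clear_off_diagonal [OF _ pos] m by metis
    \<comment> \<open>The swap moves the surviving entry \<open>b'\<close> between the first two
      diagonal entries, so the same reduction applies again, now with diagonal sum 1.\<close>
    have m': "(r + s, t, 0, b', 0, 0) \<in> veronese_surface"
      using haut_group_surface [OF hswap23_in_group haut_group_surface [OF A(1) m(1)]] A(2)
      by (simp add: pconj_linear)
    then have tr: "r + s + t = 1"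
      by (simp add: veronese_surface_iff)
    obtain B where B: "B \<in> haut_group" "B (r + s, t, 0, b', 0, 0) = (r + s + t, 0, 0, 0, 0, 0)"
      using haut_group_clear_off_diagonal [OF m'] tr by (metis zero_less_one)
    have "(B \<circ> (hswap23 \<circ> A)) m = (1, 0, 0, 0, 0, 0)"
      using A(2) B(2) tr by (simp add: pconj_linear)
    then show ?thesis
      using haut_group_comp A(1) B(1) hswap23_in_group by blast
  qed
  obtain r s t a b c where m: "m = (r, s, t, a, b, c)"
    by (rule herm_cases)
  have "r + s + t = 1"
    using assms by (simp add: m veronese_surface_iff)
  \<comment> \<open>The three pairwise sums add up to 2, so one is positive; transpositions move
    that pair to the front.\<close>
  then consider "r + s > 0" | "r + t > 0" | "s + t > 0"
    by linarith
  then show ?thesis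
  proof cases
    case 1
    then show ?thesis
      using two assms m by blast
  next
    case 2
    obtain A where "A \<in> haut_group" "A (hswap23 m) = (1, 0, 0, 0, 0, 0)"
      using two [OF haut_group_surface [OF hswap23_in_group assms] _ 2] m by auto
    then show ?thesis
      using haut_group_comp [OF _ hswap23_in_group] by (metis o_apply)
  next
    case 3
    have swaps: "hswap23 \<circ> hswap12 \<in> haut_group"
      by (rule haut_group_comp [OF hswap23_in_group hswap12_in_group])
    obtain A where "A \<in> haut_group" "A ((hswap23 \<circ> hswap12) m) = (1, 0, 0, 0, 0, 0)"
      using two [OF haut_group_surface [OF swaps assms] _ 3] m by auto
    then show ?thesis
      using haut_group_comp [OF _ swaps] by (metis o_apply)
  qed
qed

theorem theorem6p6:
  shows "\<forall>p\<in>OP2. \<forall>q\<in>OP2. \<exists>f. isometry_OP2 f \<and> f p = q"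
proof (intro ballI)
  fix p q assume p: "p \<in> OP2" and q: "q \<in> OP2"
  \<comment> \<open>Both points are moved to \<open>diag(1, 0, 0)\<close>, and the second motion is
    then reversed.\<close>
  obtain A where A: "A \<in> haut_group" "A (embed_OP2 p) = (1, 0, 0, 0, 0, 0)"
    using haut_group_to_base [OF embed_OP2_in_surface [OF p]] by blast
  obtain B where B: "B \<in> haut_group" "B (embed_OP2 q) = (1, 0, 0, 0, 0, 0)"
    using haut_group_to_base [OF embed_OP2_in_surface [OF q]] by blast
  obtain B' where B': "B' \<in> haut_group" "\<And>m. m \<in> veronese_surface \<Longrightarrow> B' (B m) = m"
    using haut_group_inverse [OF B(1)] by blast
  have "(B' \<circ> A) (embed_OP2 p) = embed_OP2 q"
    using B'(2) [OF embed_OP2_in_surface [OF q]] A(2) B(2) by simp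
  then show "\<exists>f. isometry_OP2 f \<and> f p = q"
    using isometry_if_haut_group [OF haut_group_comp [OF B'(1) A(1)] p q] by blast
qed

end
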